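(* Let $\ell\geq 3$ and $s\in\mathbb{N}_0$. Then, for $0<y<v$ (where $z=x+iy$, $\tau=u+iv$), \[ F_{\ell,s}(q) = i^\ell (q)^{\ell^2-2\ell}_{\infty} q^{-h_s-\frac{\ell}{8}}\sum_{\substack{1\leq j \leq \ell \\ j\equiv \ell\pmod{2}}} \frac{D_{-j}(\tau)}{(j-1)!}\sum_{n= 0}^\infty(-1)^{n\ell}\left(\ell n+\frac{\ell}{2}-s\right)^{j-1}q^{\frac{1}{2\ell}\left(\ell n+\frac{\ell}{2}-s\right)^2}, \] where the $D_{-j}(\tau)$ are determined by the Laurent expansion around $z=0$ \[ g_\ell(z;\tau) = \sum_{j = 1}^\ell \frac{D_{-j}(\tau)}{(2\pi i z)^j} + O(1),\qquad g_\ell(z;\tau):=\frac{\eta(\tau)^{3\ell}}{\vartheta(z;\tau)^\ell}. \]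
   Context: $\tau=u+iv$ lies in the upper half-plane, $q=e^{2\pi i\tau}$, $z=x+iy$, $\zeta=e^{2\pi iz}$, $(a)_\infty:=\prod_{j\ge0}(1-aq^j)$, $\eta(\tau):=q^{1/24}(q)_\infty$, $\vartheta(z;\tau):=\sum_{n\in\frac12+\mathbb Z}q^{n^2/2}e^{2\pi in(z+\frac12)}$, and $h_s:=\frac{s^2}{2\ell}+\frac s2$. Further \[ F_{\ell,s}(q) := (q)_\infty^{\ell^2-1} \operatorname{coeff}_{\zeta^s} \frac{(q)_\infty}{(\zeta)_\infty^\ell\left(\zeta^{-1}q\right)_\infty^\ell}, \] with the coefficient of $\zeta^s$ taken in the Laurent expansion valid for $0<y<v$. *)

theory Defs
  imports "HOL-Complex_Analysis.Complex_Analysis" "HOL-Library.Landau_Symbols"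
begin

text \<open>Powers \<^term>\<open>q\<close> to the \<^term>\<open>r\<close> with \<^term>\<open>q\<close> the nome of \<^term>\<open>\<tau>\<close>; for fractional \<^term>\<open>r\<close> this
  depends on \<^term>\<open>\<tau>\<close> and is not the principal branch of powr.\<close>

definition qpow :: "complex \<Rightarrow> real \<Rightarrow> complex" where
  "qpow \<tau> r = exp (2 * of_real pi * \<i> * \<tau> * of_real r)"

abbreviation nome :: "complex \<Rightarrow> complex" where
  "nome \<tau> \<equiv> exp (2 * of_real pi * \<i> * \<tau>)"

definition qpoch_inf :: "complex \<Rightarrow> complex \<Rightarrow> complex" where
  "qpoch_inf a q = (\<Prod>j. 1 - a * q ^ j)"

definition dedekind_eta :: "complex \<Rightarrow> complex" where
  "dedekind_eta \<tau> = qpow \<tau> (1 / 24) * qpoch_inf (nome \<tau>) (nome \<tau>)"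

text \<open>The summation index in the half-integers is written as \<^term>\<open>of_int n + 1 / 2\<close>.\<close>

definition jacobi_theta :: "complex \<Rightarrow> complex \<Rightarrow> complex" where
  "jacobi_theta z \<tau> =
     (\<Sum>\<^sub>\<infinity>n\<in>(UNIV :: int set).
        qpow \<tau> ((of_int n + 1 / 2)\<^sup>2 / 2) *
        exp (2 * of_real pi * \<i> * (of_int n + 1 / 2) * (z + 1 / 2)))"

definition h_exp :: "nat \<Rightarrow> nat \<Rightarrow> real" where
  "h_exp l s = (real s)\<^sup>2 / (2 * real l) + real s / 2"

text \<open>The coefficients of the (unique) Laurent series that represents \<^term>\<open>f\<close> on the
  open annulus around 0 with radii \<^term>\<open>r\<close> and \<^term>\<open>R\<close>.\<close>

definition annulus_laurent_coeff ::
    "real \<Rightarrow> real \<Rightarrow> (complex \<Rightarrow> complex) \<Rightarrow> int \<Rightarrow> complex" where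
  "annulus_laurent_coeff r R f =
     (THE a. \<forall>\<zeta>. r < norm \<zeta> \<and> norm \<zeta> < R \<longrightarrow>
        ((\<lambda>n. a n * \<zeta> powi n) has_sum f \<zeta>) UNIV)"

definition F_fun :: "nat \<Rightarrow> nat \<Rightarrow> complex \<Rightarrow> complex" where
  "F_fun l s q =
     qpoch_inf q q ^ (l\<^sup>2 - 1) *
     annulus_laurent_coeff (norm q) 1
       (\<lambda>\<zeta>. qpoch_inf q q / (qpoch_inf \<zeta> q ^ l * qpoch_inf (inverse \<zeta> * q) q ^ l)) (int s)"

text \<open>For \<^term>\<open>q = nome \<tau>\<close> the annulus in \<^const>\<open>F_fun\<close> is the strip \<^term>\<open>0 < Im z \<and> Im z < Im \<tau>\<close>.\<close>

lemma strip_iff_annulus: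
  "0 < Im z \<and> Im z < Im \<tau> \<longleftrightarrow>
     norm (nome \<tau>) < norm (nome z) \<and> norm (nome z) < 1"
  by (auto simp: norm_exp_eq_Re zero_less_mult_iff)

definition g_fun :: "nat \<Rightarrow> complex \<Rightarrow> complex \<Rightarrow> complex" where
  "g_fun l z \<tau> = dedekind_eta \<tau> ^ (3 * l) / jacobi_theta z \<tau> ^ l"

text \<open>\<^term>\<open>D_coeff l \<tau> j\<close> is the coefficient with index \<^term>\<open>-j\<close>; the convention that it
  vanishes for \<^term>\<open>j\<close> outside \<^term>\<open>{1..l}\<close> only serves to make the function unique.\<close>

definition D_coeff :: "nat \<Rightarrow> complex \<Rightarrow> nat \<Rightarrow> complex" where
  "D_coeff l \<tau> =
     (THE D. (\<forall>j. j \<notin> {1..l} \<longrightarrow> D j = 0) \<and>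
        (\<lambda>z. g_fun l z \<tau> - (\<Sum>j = 1..l. D j / (2 * of_real pi * \<i> * z) ^ j)) \<in> O[at 0](\<lambda>_. 1))"

end

theory Submission
  imports Defs "HOL-Real_Asymp.Real_Asymp"
begin

text \<open>
  Let \<open>f(\<zeta>) = 1 / ((\<zeta>)\<^sub>\<infinity> (q/\<zeta>)\<^sub>\<infinity>)^l\<close> have the Laurent coefficients \<open>a\<^sub>n\<close> on the annulus \<open>|q| < |\<zeta>| < 1\<close>.
  Since \<open>f(q\<zeta>) = (-\<zeta>)^l f(\<zeta>)\<close>, the coefficients on the next annulus \<open>1 < |\<zeta>| < 1/|q|\<close> are
  \<open>(-1)^l q^(n+l) a\<^sub>n\<^sub>+\<^sub>l\<close>. In the variable \<open>z\<close> with \<open>\<zeta> = e^(2\<pi>iz)\<close> both families are integrals over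
  horizontal segments of length 1, so by periodicity they differ by \<open>2\<pi>i\<close> times the residue of
  \<open>f(\<zeta>) \<zeta>^(-n)\<close> at \<open>z = 0\<close>. The Jacobi triple product identifies \<open>f\<close> with \<open>\<zeta>^(-l/2) g\<^sub>l(z)\<close> up to a constant,
  so the residue is a polynomial in \<open>n + l/2\<close> with coefficients \<open>D\<^sub>-\<^sub>j / (j-1)!\<close>. Iterating the resulting
  recursion from \<open>a\<^sub>s\<close> down to \<open>a\<^sub>s\<^sub>-\<^sub>N\<^sub>l\<close> and letting \<open>N \<rightarrow> \<infinity>\<close> gives the partial theta series; the
  \<open>D\<^sub>-\<^sub>j\<close> with \<open>j\<close> of the wrong parity vanish because \<open>\<vartheta>\<close> is odd.
\<close>

section \<open>Summability of Gaussian terms\<close>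

lemma summable_exp_quadratic:
  fixes A B :: real
  assumes "A > 0"
  shows "summable (\<lambda>n::nat. exp (B * real n - A * (real n)\<^sup>2))"
proof (rule summable_comparison_test_bigo)
  show "summable (\<lambda>n::nat. norm (exp (- real n)))"
  proof -
    have "(\<lambda>n::nat. norm (exp (- real n))) = (\<lambda>n. exp (-1) ^ n)"
      by (auto simp: exp_of_nat_mult [symmetric])
    then show ?thesis by (simp add: summable_geometric)
  qed
  show "(\<lambda>n::nat. exp (B * real n - A * (real n)\<^sup>2)) \<in> O(\<lambda>n. exp (- real n))"
    using assms by real_asymp
qed

text \<open>Splitting at 0 leaves two one-sided sums, with \<open>B\<close> and \<open>- B\<close>.
  The two ranges share the index 0, which does not affect summability.\<close>

lemma summable_on_int_exp_quadratic:
  fixes A B :: real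
  assumes "A > 0"
  shows "(\<lambda>n::int. exp (B * of_int n - A * (of_int n)\<^sup>2)) summable_on UNIV"
proof -
  let ?f = "\<lambda>n::int. exp (B * of_int n - A * (of_int n)\<^sup>2)"
  have nat: "(\<lambda>n::nat. exp (C * real n - A * (real n)\<^sup>2)) summable_on UNIV" for C
    using summable_exp_quadratic[OF assms, of C]
    by (intro norm_summable_imp_summable_on) simp
  have "?f summable_on range int"
    using nat[of B] by (subst summable_on_reindex) (auto simp: o_def)
  moreover have "?f summable_on range (\<lambda>n. - int n)"
    using nat[of "- B"] by (subst summable_on_reindex) (auto simp: o_def inj_on_def)
  moreover have "(UNIV :: int set) = range int \<union> range (\<lambda>n. - int n)"
    by (metis (mono_tags, lifting) UNIV_eq_I UnI1 UnI2 int_cases2 rangeI)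
  ultimately show ?thesis
    by (metis summable_on_union)
qed

text \<open>A series of nonnegative terms dominates each of them. This trades a polynomial factor
  for an exponential one, which a Gaussian absorbs.\<close>

lemma power_le_fact_exp:
  fixes x :: real
  assumes "x \<ge> 0"
  shows "x ^ k \<le> fact k * exp x"
proof -
  have "(\<Sum>n\<in>{k}. x ^ n /\<^sub>R fact n) \<le> (\<Sum>n. x ^ n /\<^sub>R fact n)"
    by (rule sum_le_suminf) (use assms summable_exp_generic[of x] in auto)
  then show ?thesis
    by (simp add: exp_def field_simps)
qed

section \<open>q-Pochhammer symbols\<close>

lemma convergent_prod_qpoch:
  fixes a q :: complex
  assumes "norm q < 1"
  shows "convergent_prod (\<lambda>j. 1 - a * q ^ j)"
proof (rule abs_convergent_prod_imp_convergent_prod, rule summable_imp_abs_convergent_prod)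
  show "summable (\<lambda>j. norm (1 - a * q ^ j - 1))"
    using assms by (auto simp: norm_mult norm_power intro!: summable_mult summable_geometric)
qed

lemma qpoch_LIMSEQ:
  assumes "norm q < 1"
  shows "(\<lambda>n. \<Prod>j<n. 1 - a * q ^ j) \<longlonglongrightarrow> qpoch_inf a q"
  using convergent_prod_LIMSEQ[OF convergent_prod_qpoch[OF assms, of a]]
  unfolding qpoch_inf_def by (simp add: LIMSEQ_lessThan_iff_atMost)

lemma qpoch_inf_rec:
  assumes "norm q < 1"
  shows "qpoch_inf a q = (1 - a) * qpoch_inf (a * q) q"
proof (rule LIMSEQ_unique)
  show "(\<lambda>n. \<Prod>j<Suc n. 1 - a * q ^ j) \<longlonglongrightarrow> qpoch_inf a q"
    using qpoch_LIMSEQ[OF assms] by (rule LIMSEQ_Suc)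
  have "(\<Prod>j<Suc n. 1 - a * q ^ j) = (1 - a) * (\<Prod>j<n. 1 - a * q * q ^ j)" for n
    by (subst prod.lessThan_Suc_shift) (simp add: mult.assoc)
  then show "(\<lambda>n. \<Prod>j<Suc n. 1 - a * q ^ j) \<longlonglongrightarrow> (1 - a) * qpoch_inf (a * q) q"
    by (simp only: tendsto_mult_left[OF qpoch_LIMSEQ[OF assms]])
qed

lemma one_minus_mult_power_nonzero:
  fixes a q :: complex
  assumes "norm q < 1" "norm a < 1"
  shows "1 - a * q ^ j \<noteq> 0"
proof -
  have "norm (a * q ^ j) < 1"
    using assms power_le_one[of "norm q" j]
    by (smt (verit) mult_left_le norm_ge_zero norm_mult norm_power)
  then show ?thesis
    by auto
qed

lemma qpoch_inf_nonzero:
  assumes "norm q < 1" "norm a < 1"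
  shows "qpoch_inf a q \<noteq> 0"
  unfolding qpoch_inf_def
  by (rule prodinf_nonzero) (use assms convergent_prod_qpoch one_minus_mult_power_nonzero in blast)+

text \<open>The partial products are entire and converge uniformly on discs, by the M-test with the
  geometric majorant \<open>?M * norm q ^ n\<close>; the radius 1 is arbitrary.\<close>

lemma holomorphic_on_qpoch_inf:
  assumes "norm q < 1"
  shows "(\<lambda>a. qpoch_inf a q) holomorphic_on A"
proof -
  have "(\<lambda>a. qpoch_inf a q) holomorphic_on UNIV"
  proof (rule holomorphic_uniform_sequence)
    fix x :: complex
    let ?K = "cball x 1"
    let ?M = "norm x + 1"
    have "uniformly_convergent_on ?K (\<lambda>N a. \<Sum>n<N. norm (1 - a * q ^ n - 1))"
    proof (rule Weierstrass_m_test'_ev)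
      show "\<forall>\<^sub>F n in sequentially. \<forall>a\<in>?K. norm (norm (1 - a * q ^ n - 1)) \<le> ?M * norm q ^ n"
      proof (intro always_eventually allI ballI)
        fix n a assume "a \<in> ?K"
        then have "norm a \<le> ?M"
          using norm_triangle_ineq2[of a x] by (simp add: dist_norm norm_minus_commute)
        then show "norm (norm (1 - a * q ^ n - 1)) \<le> ?M * norm q ^ n"
          by (simp add: norm_mult norm_power mult_right_mono)
      qed
      show "summable (\<lambda>n. ?M * norm q ^ n)"
        using assms by (intro summable_mult summable_geometric) simp
    qed
    then have "uniformly_convergent_on ?K (\<lambda>N a. \<Prod>n<N. 1 - a * q ^ n)"
      by (intro uniformly_convergent_on_prod') (auto intro!: continuous_intros)
    then obtain g where g: "uniform_limit ?K (\<lambda>N a. \<Prod>n<N. 1 - a * q ^ n) g sequentially"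
      by (auto simp: uniformly_convergent_on_def)
    have "g a = qpoch_inf a q" if "a \<in> ?K" for a
      using tendsto_uniform_limitI[OF g that] qpoch_LIMSEQ[OF assms] LIMSEQ_unique by blast
    with g have "uniform_limit ?K (\<lambda>N a. \<Prod>n<N. 1 - a * q ^ n) (\<lambda>a. qpoch_inf a q) sequentially"
      by (metis (mono_tags, lifting) uniform_limit_cong')
    then show "\<exists>d. 0 < d \<and> cball x d \<subseteq> UNIV \<and>
        uniform_limit (cball x d) (\<lambda>N a. \<Prod>n<N. 1 - a * q ^ n) (\<lambda>a. qpoch_inf a q) sequentially"
      by (intro exI[of _ 1]) auto
  qed (auto intro!: holomorphic_intros)
  then show ?thesis
    using holomorphic_on_subset by blast
qed

section \<open>The Jacobi triple product\<close>

fun gauss_binom :: "complex \<Rightarrow> nat \<Rightarrow> nat \<Rightarrow> complex" where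
  "gauss_binom q n 0 = 1"
| "gauss_binom q 0 (Suc k) = 0"
| "gauss_binom q (Suc n) (Suc k) = gauss_binom q n (Suc k) + q ^ (n - k) * gauss_binom q n k"

lemma gauss_binom_eq_0: "n < k \<Longrightarrow> gauss_binom q n k = 0"
  by (induction q n k rule: gauss_binom.induct) auto

lemma gauss_binom_same: "gauss_binom q n n = 1"
  by (induction n) (auto simp: gauss_binom_eq_0)

text \<open>This is the finite symbol (q;q)_n, without the customary denominator (1 - q)^n, so that
  for |q| < 1 it tends to \<open>qpoch_inf q q\<close>.\<close>

definition qfact :: "complex \<Rightarrow> nat \<Rightarrow> complex" where
  "qfact q n = (\<Prod>j<n. 1 - q * q ^ j)"

text \<open>In both terms of the q-Pascal rule the total \<open>m + k\<close> drops by one, and they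
  combine through (1 - q^(m'+1)) + q^(m'+1) (1 - q^(k'+1)) = 1 - q^(m'+k'+2).\<close>

lemma gauss_binom_qfact: "gauss_binom q (m + k) k * (qfact q k * qfact q m) = qfact q (m + k)"
proof (induction "m + k" arbitrary: m k)
  case 0
  then show ?case by (simp add: qfact_def)
next
  case (Suc N)
  consider "k = 0" | "m = 0" | m' k' where "m = Suc m'" "k = Suc k'"
    by (metis not0_implies_Suc)
  then show ?case
  proof cases
    case 3
    let ?b1 = "gauss_binom q (m' + Suc k') (Suc k')"
    let ?b2 = "gauss_binom q (Suc m' + k') k'"
    have 1: "?b1 * (qfact q (Suc k') * qfact q m') = qfact q (Suc (m' + k'))"
      using Suc.hyps(1)[of m' "Suc k'"] Suc.hyps(2) 3 by simp
    have 2: "?b2 * (qfact q k' * qfact q (Suc m')) = qfact q (Suc (m' + k'))"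
      using Suc.hyps(1)[of "Suc m'" "k'"] Suc.hyps(2) 3 by simp
    have q: "qfact q (Suc n) = qfact q n * (1 - q ^ Suc n)" for n
      by (simp add: qfact_def)
    have "gauss_binom q (m + k) k = ?b1 + q ^ Suc m' * ?b2"
      using 3 by simp
    also have "\<dots> * (qfact q k * qfact q m) =
        ?b1 * (qfact q (Suc k') * qfact q m') * (1 - q ^ Suc m') +
        q ^ Suc m' * (?b2 * (qfact q k' * qfact q (Suc m'))) * (1 - q ^ Suc k')"
      unfolding 3 q by (simp add: algebra_simps del: gauss_binom.simps)
    also have "\<dots> = qfact q (Suc (m' + k')) * (1 - q ^ Suc (Suc (m' + k')))"
      unfolding 1 2 by (simp add: algebra_simps power_add)
    also have "\<dots> = qfact q (m + k)"
      using 3 q[of "Suc (m' + k')"] by simp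
    finally show ?thesis .
  qed (auto simp: qfact_def gauss_binom_same)
qed

lemma qfact_nonzero:
  assumes "norm q < 1"
  shows "qfact q n \<noteq> 0"
  using one_minus_mult_power_nonzero[OF assms assms] by (simp add: qfact_def)

text \<open>Multiplication by the new factor 1 + x q^n acts on the coefficients exactly as the
  q-Pascal rule.\<close>

lemma prod_gauss_binom:
  fixes x :: complex
  shows "(\<Prod>j<n. 1 + x * q ^ j) = (\<Sum>k\<le>n. q ^ (k * (k - 1) div 2) * gauss_binom q n k * x ^ k)"
proof (induction n)
  case (Suc n)
  let ?c = "\<lambda>n k. q ^ (k * (k - 1) div 2) * gauss_binom q n k * x ^ k"
  have step: "?c (Suc n) (Suc k) = ?c n (Suc k) + x * q ^ n * ?c n k" if "k \<le> n" for k
  proof -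
    \<comment> \<open>Passing from k to k + 1 raises the triangular number k (k - 1) / 2 by k, which
      completes q^(n-k) to q^n.\<close>
    have "Suc k * (Suc k - 1) div 2 + (n - k) = n + k * (k - 1) div 2"
    proof -
      have "Suc k * (Suc k - 1) = k * (k - 1) + 2 * k"
        by (cases k) (auto simp: algebra_simps)
      then show ?thesis
        using that by simp
    qed
    then have "q ^ (Suc k * (Suc k - 1) div 2) * q ^ (n - k) = q ^ n * q ^ (k * (k - 1) div 2)"
      by (metis power_add)
    then show ?thesis
      by (simp only: gauss_binom.simps power_Suc) (simp add: algebra_simps)
  qed
  have "(\<Sum>k\<le>Suc n. ?c (Suc n) k) = 1 + (\<Sum>k\<le>n. ?c (Suc n) (Suc k))"
    by (subst sum.atMost_Suc_shift) simp
  also have "(\<Sum>k\<le>n. ?c (Suc n) (Suc k)) = (\<Sum>k\<le>n. ?c n (Suc k)) + x * q ^ n * (\<Sum>k\<le>n. ?c n k)"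
    using step by (simp add: sum.distrib sum_distrib_left)
  also have "1 + \<dots> = (\<Sum>k\<le>Suc n. ?c n k) + x * q ^ n * (\<Sum>k\<le>n. ?c n k)"
    by (subst sum.atMost_Suc_shift) simp
  also have "(\<Sum>k\<le>Suc n. ?c n k) = (\<Sum>k\<le>n. ?c n k)"
    by (simp add: gauss_binom_eq_0)
  finally show ?case
    using Suc.IH by (simp add: algebra_simps)
qed auto


text \<open>The q-binomial theorem for 2 N factors at x = - w / q^N. The upper N factors are 1 - w
  q^j; the lower ones, read backwards, become 1 - (q / w) q^i once - w / q^(i+1) is pulled out of
  each.\<close>

lemma jacobi_triple_product_finite:
  fixes q w :: complex
  assumes "q \<noteq> 0" "w \<noteq> 0"
  shows "(\<Prod>j<N. 1 - w * q ^ j) * (\<Prod>j<N. 1 - q / w * q ^ j) =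
    (\<Sum>k\<le>2 * N. gauss_binom q (2 * N) k *
      (q powi ((int k - int N) * (int k - int N - 1) div 2) * (- w) powi (int k - int N)))"
proof -
  let ?x = "- w / q ^ N"
  let ?c = "(- w) ^ N / q ^ (N * Suc N div 2)"
  have "(\<Prod>j<2 * N. 1 + ?x * q ^ j) = (\<Prod>j<N. 1 + ?x * q ^ j) * (\<Prod>j=N..<N + N. 1 + ?x * q ^ j)"
    using prod.atLeastLessThan_concat[of 0 N "N + N" "\<lambda>j. 1 + ?x * q ^ j"]
    by (simp add: atLeast0LessThan mult_2)
  also have "(\<Prod>j=N..<N + N. 1 + ?x * q ^ j) = (\<Prod>j<N. 1 - w * q ^ j)"
    using prod.shift_bounds_nat_ivl[of "\<lambda>j. 1 + ?x * q ^ j" 0 N N] assms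
    by (simp add: atLeast0LessThan power_add)
  also have "(\<Prod>j<N. 1 + ?x * q ^ j) = (\<Prod>i<N. 1 + ?x * q ^ (N - Suc i))"
    by (rule prod.nat_diff_reindex[symmetric])
  also have "\<dots> = (\<Prod>i<N. (- w / q ^ Suc i) * (1 - q / w * q ^ i))"
  proof (rule prod.cong)
    fix i assume "i \<in> {..<N}"
    then have "q ^ N = q ^ (N - Suc i) * q ^ Suc i"
      by (simp flip: power_add power_Suc)
    then show "1 + ?x * q ^ (N - Suc i) = (- w / q ^ Suc i) * (1 - q / w * q ^ i)"
      using assms by (simp add: field_simps)
  qed simp
  also have "\<dots> = (\<Prod>i<N. - w / q ^ Suc i) * (\<Prod>i<N. 1 - q / w * q ^ i)"
    by (rule prod.distrib)
  also have "(\<Prod>i<N. - w / q ^ Suc i) = ?c"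
  proof (induction N)
    case (Suc N)
    have "Suc N * Suc (Suc N) div 2 = N * Suc N div 2 + Suc N"
      by simp
    then show ?case
      using Suc assms by (simp add: power_add mult_ac del: mult_Suc mult_Suc_right)
  qed auto
  finally have "?c * ((\<Prod>j<N. 1 - w * q ^ j) * (\<Prod>j<N. 1 - q / w * q ^ j)) =
      (\<Sum>k\<le>2 * N. q ^ (k * (k - 1) div 2) * gauss_binom q (2 * N) k * ?x ^ k)"
    unfolding prod_gauss_binom by (simp only: mult_ac)
  then have "(\<Prod>j<N. 1 - w * q ^ j) * (\<Prod>j<N. 1 - q / w * q ^ j) =
      (\<Sum>k\<le>2 * N. q ^ (k * (k - 1) div 2) * gauss_binom q (2 * N) k * ?x ^ k) / ?c"
    using assms by (simp add: field_simps)
  also have "\<dots> = (\<Sum>k\<le>2 * N. gauss_binom q (2 * N) k *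
      (q powi ((int k - int N) * (int k - int N - 1) div 2) * (- w) powi (int k - int N)))"
    unfolding sum_divide_distrib
  proof (rule sum.cong)
    fix k
    let ?m = "int k - int N"
    \<comment> \<open>All three exponents are halves of even integers; doubling turns the relation
      between them into a polynomial identity.\<close>
    have e: "2 * (x div 2) = x" if "even x" for x :: int
      using that by simp
    have "2 * (?m * (?m - 1) div 2) = ?m * (?m - 1)"
      by (rule e) auto
    moreover have "2 * int (k * (k - 1) div 2) = int k * (int k - 1)"
    proof -
      have "int (k * (k - 1) div 2) = int k * (int k - 1) div 2"
        by (cases k) (auto simp: zdiv_int algebra_simps)
      then show ?thesis
        using e[of "int k * (int k - 1)"] by simp
    qed
    moreover have "2 * int (N * Suc N div 2) = int N * (int N + 1)"
      using e[of "int N * (int N + 1)"] by (simp add: zdiv_int algebra_simps)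
    ultimately have "?m * (?m - 1) div 2 = int (k * (k - 1) div 2) + int (N * Suc N div 2) - int (N * k)"
      by (simp add: algebra_simps)
    then have "q powi (?m * (?m - 1) div 2) = q ^ (k * (k - 1) div 2) * q ^ (N * Suc N div 2) / q ^ (N * k)"
      using assms by (simp only: power_int_add power_int_diff power_int_of_nat simp_thms)
    moreover have "(- w) powi ?m = (- w) ^ k / (- w) ^ N"
      using assms by (simp add: power_int_diff)
    moreover have "?x ^ k = (- w) ^ k / q ^ (N * k)"
      by (simp only: power_divide power_mult)
    ultimately show "q ^ (k * (k - 1) div 2) * gauss_binom q (2 * N) k * ?x ^ k / ?c =
        gauss_binom q (2 * N) k * (q powi (?m * (?m - 1) div 2) * (- w) powi ?m)"
      by simp
  qed simp
  finally show ?thesis .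
qed

lemma summable_on_theta:
  fixes q w :: complex
  assumes "norm q < 1" "q \<noteq> 0" "w \<noteq> 0"
  shows "(\<lambda>m. norm (q powi (m * (m - 1) div 2) * w powi m)) summable_on UNIV"
proof -
  have "norm (q powi (m * (m - 1) div 2) * w powi m) =
      exp ((ln (norm w) - ln (norm q) / 2) * of_int m - (- ln (norm q) / 2) * (of_int m)\<^sup>2)" for m
  proof -
    have e: "real_of_int (m * (m - 1) div 2) = of_int m * (of_int m - 1) / 2"
      by (subst real_of_int_div) auto
    have "norm (x powi k) = exp (of_int k * ln (norm x))" if "x \<noteq> 0" for k :: int and x :: complex
    proof -
      have "norm (x powi k) = norm x powr of_int k"
        using that by (simp add: norm_power_int powr_real_of_int')
      then show ?thesis
        using that by (simp add: powr_def)
    qed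
    then show ?thesis
      using assms by (simp add: norm_mult e exp_add [symmetric])
        (simp add: power2_eq_square field_simps)
  qed
  then show ?thesis
    using summable_on_int_exp_quadratic[of "- ln (norm q) / 2" "ln (norm w) - ln (norm q) / 2"] assms
    by simp
qed

text \<open>The finite identity passes to the limit by dominated convergence: the Gaussian binomial
  coefficients are bounded and tend to \<^term>\<open>1 / qpoch_inf q q\<close>.\<close>

theorem jacobi_triple_product:
  fixes q w :: complex
  assumes "norm q < 1" "q \<noteq> 0" "w \<noteq> 0"
  shows "((\<lambda>m. q powi (m * (m - 1) div 2) * (- w) powi m) has_sum
     (qpoch_inf q q * qpoch_inf w q * qpoch_inf (q / w) q)) UNIV"
proof -
  define t where "t = (\<lambda>m. q powi (m * (m - 1) div 2) * (- w) powi m)"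
  \<comment> \<open>Extended by zero beyond |m| \<le> N, the finite sums all run over the integers,
    so that the limit in N can be taken termwise.\<close>
  define b where "b = (\<lambda>m N. if \<bar>m\<bar> \<le> int N then gauss_binom q (2 * N) (nat (m + int N)) else 0)"
  let ?P = "qpoch_inf q q"
  have P0: "?P \<noteq> 0"
    using qpoch_inf_nonzero assms by blast
  have lim: "qfact q \<longlonglongrightarrow> ?P"
    using qpoch_LIMSEQ[of q q] assms unfolding qfact_def by simp
  have b_eq: "b m N = qfact q (2 * N) / (qfact q (nat (int N + m)) * qfact q (nat (int N - m)))"
    if "\<bar>m\<bar> \<le> int N" for m N
  proof -
    have "nat (int N - m) + nat (int N + m) = 2 * N"
      using that by linarith
    with gauss_binom_qfact[of q "nat (int N - m)" "nat (int N + m)"] that show ?thesis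
      using qfact_nonzero[OF assms(1)] by (simp add: b_def field_simps)
  qed
  have b_lim: "b m \<longlonglongrightarrow> 1 / ?P" for m
  proof -
    have "filterlim (\<lambda>N. nat (int N + m)) at_top sequentially" for m
    proof (rule filterlim_at_top_mono)
      show "filterlim (\<lambda>N. N - nat \<bar>m\<bar>) at_top sequentially"
        by (rule filterlim_minus_const_nat_at_top)
      show "\<forall>\<^sub>F N in sequentially. N - nat \<bar>m\<bar> \<le> nat (int N + m)"
        by (intro always_eventually allI) linarith
    qed
    from this[of m] this[of "- m"]
    have "(\<lambda>N. qfact q (2 * N) / (qfact q (nat (int N + m)) * qfact q (nat (int N - m)))) \<longlonglongrightarrow> ?P / (?P * ?P)"
      by (intro tendsto_intros filterlim_compose[OF lim]) (auto simp: P0 intro: mult_nat_left_at_top)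
    then have "(\<lambda>N. qfact q (2 * N) / (qfact q (nat (int N + m)) * qfact q (nat (int N - m)))) \<longlonglongrightarrow> 1 / ?P"
      using P0 by simp
    moreover have "\<forall>\<^sub>F N in sequentially. b m N =
        qfact q (2 * N) / (qfact q (nat (int N + m)) * qfact q (nat (int N - m)))"
      using eventually_ge_at_top[of "nat \<bar>m\<bar>"] by eventually_elim (rule b_eq, linarith)
    ultimately show ?thesis
      by (simp add: filterlim_cong)
  qed
  \<comment> \<open>Both \<open>qfact q\<close> and its inverse converge, the limit being nonzero,
    and hence are bounded.\<close>
  obtain C where C: "norm (b m N) \<le> C" for m N
  proof -
    obtain K where K: "norm (qfact q n) \<le> K" for n
      using convergent_imp_Bseq[OF convergentI[OF lim]] by (auto simp: Bseq_def)
    have "(\<lambda>n. inverse (qfact q n)) \<longlonglongrightarrow> inverse ?P"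
      using lim P0 by (rule tendsto_inverse)
    from convergent_imp_Bseq[OF convergentI[OF this]]
    obtain L where L: "norm (inverse (qfact q n)) \<le> L" for n
      by (auto simp: Bseq_def)
    have 0: "0 \<le> K" "0 \<le> L"
      using K[of 0] L[of 0] norm_ge_zero order_trans by blast+
    have "norm (b m N) \<le> K * (L * L)" for m N
    proof (cases "\<bar>m\<bar> \<le> int N")
      case True
      have "b m N = qfact q (2 * N) *
         (inverse (qfact q (nat (int N + m))) * inverse (qfact q (nat (int N - m))))"
        unfolding b_eq[OF True] by (simp add: field_simps)
      then show ?thesis
        using K L 0 by (auto simp: norm_mult simp del: norm_inverse intro!: mult_mono)
    qed (use 0 in \<open>auto simp: b_def\<close>)
    then show ?thesis
      using that by blast
  qed
  have summable: "(\<lambda>m. norm (t m)) summable_on UNIV"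
    using summable_on_theta[of q "- w"] assms by (simp add: t_def)
  have summable_t: "t summable_on UNIV"
    using summable by (rule abs_summable_summable)
  have "(\<lambda>N. \<Sum>\<^sub>\<infinity>m. t m * b m N) \<longlonglongrightarrow> infsum t UNIV * (1 / ?P)"
  \<comment> \<open>The majorant \<open>norm (t m) * C\<close> is independent of N, so the finite
    partial sums converge uniformly in N and the two limits may be interchanged.\<close>
  proof (rule swap_uniform_limit')
    show "\<forall>\<^sub>F X in finite_subsets_at_top UNIV. (\<lambda>N. \<Sum>m\<in>X. t m * b m N) \<longlonglongrightarrow> (\<Sum>m\<in>X. t m * (1 / ?P))"
      by (intro always_eventually allI tendsto_intros b_lim)
    show "((\<lambda>X. \<Sum>m\<in>X. t m * (1 / ?P)) \<longlongrightarrow> infsum t UNIV * (1 / ?P)) (finite_subsets_at_top UNIV)"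
      using has_sum_cmult_left[OF has_sum_infsum[OF summable_t], of "1 / ?P"] by (simp add: has_sum_def)
    show "uniform_limit UNIV (\<lambda>X N. \<Sum>m\<in>X. t m * b m N) (\<lambda>N. \<Sum>\<^sub>\<infinity>m. t m * b m N)
        (finite_subsets_at_top UNIV)"
      by (rule Weierstrass_m_test_general[where M = "\<lambda>m. norm (t m) * C"])
         (use C in \<open>auto simp: norm_mult intro!: mult_left_mono summable_on_cmult_left summable\<close>)
  qed auto
  moreover have "(\<Sum>\<^sub>\<infinity>m. t m * b m N) = (\<Prod>j<N. 1 - w * q ^ j) * (\<Prod>j<N. 1 - q / w * q ^ j)" for N
  proof -
    have "(\<Sum>\<^sub>\<infinity>m. t m * b m N) = (\<Sum>\<^sub>\<infinity>m\<in>{- int N..int N}. t m * b m N)"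
      by (rule infsum_cong_neutral) (auto simp: b_def)
    also have "\<dots> = (\<Sum>m\<in>{- int N..int N}. t m * b m N)"
      by simp
    also have "\<dots> = (\<Sum>k\<le>2 * N. t (int k - int N) * gauss_binom q (2 * N) k)"
      by (rule sum.reindex_bij_witness[of _ "\<lambda>k. int k - int N" "\<lambda>m. nat (m + int N)"])
         (auto simp: b_def)
    also have "\<dots> = (\<Prod>j<N. 1 - w * q ^ j) * (\<Prod>j<N. 1 - q / w * q ^ j)"
      using jacobi_triple_product_finite[OF assms(2,3)] by (simp add: t_def mult_ac)
    finally show ?thesis .
  qed
  moreover have "(\<lambda>N. (\<Prod>j<N. 1 - w * q ^ j) * (\<Prod>j<N. 1 - q / w * q ^ j)) \<longlonglongrightarrow>
      qpoch_inf w q * qpoch_inf (q / w) q"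
    by (intro tendsto_mult qpoch_LIMSEQ assms)
  ultimately have "infsum t UNIV * (1 / ?P) = qpoch_inf w q * qpoch_inf (q / w) q"
    using LIMSEQ_unique by simp
  then have "infsum t UNIV = ?P * qpoch_inf w q * qpoch_inf (q / w) q"
    using P0 by (simp add: field_simps)
  then show ?thesis
    using has_sum_infsum[OF summable_t] by (simp add: t_def)
qed

section \<open>Laurent coefficients as contour integrals\<close>

lemma norm_nome: "norm (nome z) = exp (- 2 * pi * Im z)"
  by (simp add: norm_exp_eq_Re)

text \<open>In the coordinate z the n-th coefficient is an integral over one horizontal period,
  without a factor 2 pi i: the k-th term integrates to 0 unless k = n. Convergence on a single
  circle suffices, and the starting abscissa x is free.\<close>

lemma laurent_coeff_contour_integral:
  fixes a :: "int \<Rightarrow> complex"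
  assumes "\<And>\<zeta>. norm \<zeta> = exp (- 2 * pi * y) \<Longrightarrow> ((\<lambda>k. a k * \<zeta> powi k) has_sum f \<zeta>) UNIV"
  shows "((\<lambda>z. f (nome z) * exp (- 2 * of_real pi * \<i> * of_int n * z)) has_contour_integral a n)
    (linepath (Complex x y) (Complex (x + 1) y))"
proof -
  let ?\<gamma> = "linepath (Complex x y) (Complex (x + 1) y)"
  let ?F = "\<lambda>z. f (nome z) * exp (- 2 * of_real pi * \<i> * of_int n * z)"
  define T where "T = (\<lambda>k z. a k * exp (2 * of_real pi * \<i> * of_int (k - n) * z))"
  have Im: "Im z = y" if "z \<in> path_image ?\<gamma>" for z
    using that by (auto simp: closed_segment_same_Im)
  have T_eq: "T k z = a k * nome z powi k * exp (- 2 * of_real pi * \<i> * of_int n * z)" for k z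
  proof -
    have "2 * of_real pi * \<i> * of_int (k - n) * z =
        of_int k * (2 * of_real pi * \<i> * z) + (- 2 * of_real pi * \<i> * of_int n * z)"
      by (simp add: algebra_simps)
    then show ?thesis
      by (simp only: T_def exp_power_int exp_add mult.assoc)
  qed
  have has_sum: "((\<lambda>k. T k z) has_sum ?F z) UNIV" if "z \<in> path_image ?\<gamma>" for z
    unfolding T_eq by (intro has_sum_cmult_left assms) (use Im[OF that] norm_nome in auto)
  have norm_T: "norm (T k z) = norm (a k) * exp (- (2 * pi * (of_int (k - n) * Im z)))" for k z
    by (simp add: T_def norm_mult norm_exp_eq_Re)
  have T_int: "(T k has_contour_integral (if k = n then a n else 0)) ?\<gamma>" for k
  proof (cases "k = n")
    case True
    have "a n * (Complex (x + 1) y - Complex x y) = a n"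
      by (simp add: complex_eq_iff)
    then have "((\<lambda>z. a n) has_contour_integral a n) ?\<gamma>"
      using has_contour_integral_const_linepath[of "a n" "Complex (x + 1) y" "Complex x y"]
      by (simp only:)
    with True show ?thesis
      by (simp add: T_def)
  next
    case False
    define c where "c = 2 * of_real pi * \<i> * of_int (k - n)"
    have "c \<noteq> 0"
      using False by (simp add: c_def)
    then have "((\<lambda>z. a k * exp (c * z) / c) has_field_derivative T k z) (at z within UNIV)" for z
      unfolding T_def c_def[symmetric] by (auto intro!: derivative_eq_intros)
    from contour_integral_primitive[of UNIV, OF this, of ?\<gamma>]
    have "(T k has_contour_integral
        a k * exp (c * Complex (x + 1) y) / c - a k * exp (c * Complex x y) / c) ?\<gamma>"
      by simp
    moreover have "exp (c * Complex (x + 1) y) = exp (c * Complex x y)"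
    proof -
      have "c * Complex (x + 1) y = c * Complex x y + \<i> * (of_int (k - n) * (of_real pi * 2))"
        by (simp add: c_def Complex_eq algebra_simps)
      then show ?thesis
        by (simp only: exp_plus_2pin)
    qed
    ultimately show ?thesis
      using False by simp
  qed
  have lim: "uniform_limit (path_image ?\<gamma>) (\<lambda>X z. \<Sum>k\<in>X. T k z) ?F (finite_subsets_at_top UNIV)"
  proof (rule Weierstrass_m_test_general')
    \<comment> \<open>Along the segment Im z is constant, hence so is the norm of each term;
      summability at one endpoint is absolute and supplies the majorant.\<close>
    fix k z assume "z \<in> path_image ?\<gamma>"
    then show "norm (T k z) \<le> norm (T k (Complex x y))"
      using Im by (simp add: norm_T)
  next
    show "(\<lambda>k. norm (T k (Complex x y))) summable_on UNIV"
      using has_sum_imp_summable[OF has_sum[of "Complex x y"]]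
      unfolding summable_on_iff_abs_summable_on_complex by simp
  qed (rule has_sum)
  have sum_int: "((\<lambda>z. \<Sum>k\<in>X. T k z) has_contour_integral (\<Sum>k\<in>X. if k = n then a n else 0)) ?\<gamma>"
    if "finite X" for X
    using has_contour_integral_sum[OF that T_int] by simp
  have ev: "\<forall>\<^sub>F X in finite_subsets_at_top UNIV. (\<lambda>z. \<Sum>k\<in>X. T k z) contour_integrable_on ?\<gamma>"
    using sum_int by (auto simp: contour_integrable_on_def eventually_finite_subsets_at_top)
  have bound: "norm (vector_derivative ?\<gamma> (at t)) \<le> 1" if "t \<in> {0..1}" for t
    by (simp add: vector_derivative_linepath_at norm_complex_def)
  note * = contour_integral_uniform_limit[OF ev lim bound valid_path_linepath finite_subsets_at_top_neq_bot]
  have "\<forall>\<^sub>F X in finite_subsets_at_top UNIV. contour_integral ?\<gamma> (\<lambda>z. \<Sum>k\<in>X. T k z) = a n"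
    unfolding eventually_finite_subsets_at_top
  proof (intro exI[of _ "{n}"] conjI allI impI)
    fix X assume X: "finite X \<and> {n} \<subseteq> X \<and> X \<subseteq> UNIV"
    then show "contour_integral ?\<gamma> (\<lambda>z. \<Sum>k\<in>X. T k z) = a n"
      using contour_integral_unique[OF sum_int[of X]] by (simp add: sum.delta)
  qed auto
  then have "((\<lambda>X. contour_integral ?\<gamma> (\<lambda>z. \<Sum>k\<in>X. T k z)) \<longlongrightarrow> a n) (finite_subsets_at_top UNIV)"
    by (rule tendsto_eventually)
  then have "contour_integral ?\<gamma> ?F = a n"
    using *(2) tendsto_unique[OF finite_subsets_at_top_neq_bot] by blast
  then show ?thesis
    using has_contour_integral_integral[OF *(1)] by (simp only:)
qed

text \<open>Any two admissible families equal the same contour integrals over one circle inside the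
  annulus. This uniqueness discharges the definite description.\<close>

lemma annulus_laurent_coeff_eqI:
  assumes "0 \<le> r" "r < R"
  assumes "\<And>\<zeta>. r < norm \<zeta> \<Longrightarrow> norm \<zeta> < R \<Longrightarrow> ((\<lambda>n. a n * \<zeta> powi n) has_sum f \<zeta>) UNIV"
  shows "annulus_laurent_coeff r R f = a"
  unfolding annulus_laurent_coeff_def
proof (rule the_equality)
  fix b assume b: "\<forall>\<zeta>. r < norm \<zeta> \<and> norm \<zeta> < R \<longrightarrow> ((\<lambda>n. b n * \<zeta> powi n) has_sum f \<zeta>) UNIV"
  obtain \<rho> where \<rho>: "r < \<rho>" "\<rho> < R"
    using assms(2) dense by blast
  \<comment> \<open>At this height \<open>nome\<close> maps the line Im z = y onto the circle of
    radius \<rho>.\<close>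
  define y where "y = - ln \<rho> / (2 * pi)"
  have y: "exp (- 2 * pi * y) = \<rho>"
    using \<rho> assms by (simp add: y_def)
  show "b = a"
  proof
    fix n
    have "((\<lambda>z. f (nome z) * exp (- 2 * of_real pi * \<i> * of_int n * z)) has_contour_integral b n)
        (linepath (Complex 0 y) (Complex (0 + 1) y))"
      by (rule laurent_coeff_contour_integral) (use b \<rho> y in auto)
    moreover have "((\<lambda>z. f (nome z) * exp (- 2 * of_real pi * \<i> * of_int n * z)) has_contour_integral a n)
        (linepath (Complex 0 y) (Complex (0 + 1) y))"
      by (rule laurent_coeff_contour_integral) (use assms \<rho> y in auto)
    ultimately show "b n = a n"
      by (rule has_contour_integral_unique)
  qed
qed (use assms in blast)

text \<open>Both \<zeta> and q / \<zeta> lie in the unit disc, so the double series converges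
  absolutely and may be regrouped along m - k = n. The coefficients stay unevaluated; only the
  existence of an expansion is used later.\<close>

lemma has_sum_laurent_product:
  fixes p :: "nat \<Rightarrow> complex"
  assumes p: "\<And>w. norm w < 1 \<Longrightarrow> (\<lambda>n. p n * w ^ n) sums \<phi> w"
  assumes \<zeta>: "norm q < norm \<zeta>" "norm \<zeta> < 1"
  shows "((\<lambda>n. (\<Sum>\<^sub>\<infinity>(m, k)\<in>{(m, k). int m - int k = n}. p m * p k * q ^ k) * \<zeta> powi n)
    has_sum \<phi> \<zeta> * \<phi> (q / \<zeta>)) UNIV"
proof -
  have \<zeta>0: "\<zeta> \<noteq> 0"
    using \<zeta> by auto
  \<comment> \<open>Convergence at a slightly larger radius r < 1 gives absolute convergence at
    w.\<close>
  have abs: "summable (\<lambda>n. norm (p n * w ^ n))" if w: "norm w < 1" for w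
  proof -
    obtain r where r: "norm w < r" "r < 1"
      using dense[OF w] by blast
    then have "summable (\<lambda>n. p n * of_real r ^ n)"
      using p[of "of_real r"] norm_ge_zero[of w] by (intro sums_summable[of _ "\<phi> (of_real r)"]) simp
    then show ?thesis
      by (rule powser_insidea) (use r in auto)
  qed
  have has_sum: "((\<lambda>n. p n * w ^ n) has_sum \<phi> w) UNIV" if "norm w < 1" for w
    using norm_summable_imp_has_sum[OF abs p] that by blast
  have abs': "(\<lambda>n. norm (p n * w ^ n)) summable_on UNIV" if "norm w < 1" for w
    using abs[OF that] by (intro summable_nonneg_imp_summable_on) auto
  have q\<zeta>: "norm (q / \<zeta>) < 1"
    using \<zeta> \<zeta>0 by (simp add: norm_divide)
  let ?f = "\<lambda>(m, k). (p m * \<zeta> ^ m) * (p k * (q / \<zeta>) ^ k)"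
  have "(\<lambda>x. norm (?f x)) summable_on UNIV \<times> UNIV"
    unfolding Infinite_Sum.abs_summable_on_Sigma_iff
    using abs'[OF \<zeta>(2)] abs'[OF q\<zeta>]
    by (auto simp: norm_mult norm_power norm_divide infsum_cmult_right' infsum_nonneg
        intro!: summable_on_cmult_right summable_on_cmult_left)
  then have summable: "?f summable_on UNIV \<times> UNIV"
    by (rule abs_summable_summable)
  have "(?f has_sum \<phi> \<zeta> * \<phi> (q / \<zeta>)) (UNIV \<times> UNIV)"
    by (rule has_sum_SigmaI[OF _ _ summable, where g = "\<lambda>m. p m * \<zeta> ^ m * \<phi> (q / \<zeta>)"])
       (auto intro!: has_sum_cmult_right has_sum_cmult_left has_sum \<zeta> q\<zeta>)
  also have "?this \<longleftrightarrow> ((\<lambda>(n, mk). ?f mk) has_sum \<phi> \<zeta> * \<phi> (q / \<zeta>))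
      (Sigma UNIV (\<lambda>n. {(m, k). int m - int k = n}))"
    by (rule has_sum_reindex_bij_witness[of _ snd "\<lambda>(m, k). (int m - int k, (m, k))"]) auto
  finally have *: "((\<lambda>(n, mk). ?f mk) has_sum \<phi> \<zeta> * \<phi> (q / \<zeta>))
      (Sigma UNIV (\<lambda>n. {(m, k). int m - int k = n}))" .
  show ?thesis
  proof (rule has_sum_SigmaD[OF *])
    fix n
    let ?A = "{(m, k). int m - int k = n}"
    have "?f summable_on ?A"
      using summable by (rule summable_on_subset_banach) auto
    then have "(?f has_sum infsum ?f ?A) ?A"
      by simp
    also have "infsum ?f ?A = infsum (\<lambda>(m, k). p m * p k * q ^ k * \<zeta> powi n) ?A"
    proof (rule infsum_cong, clarify)
      fix m k :: nat
      have "\<zeta> ^ m = \<zeta> powi (int m - int k) * \<zeta> ^ k"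
        using \<zeta>0 by (simp add: power_int_diff)
      then show "p m * \<zeta> ^ m * (p k * (q / \<zeta>) ^ k) = p m * p k * q ^ k * \<zeta> powi (int m - int k)"
        using \<zeta>0 by (simp add: power_divide)
    qed
    also have "\<dots> = infsum (\<lambda>(m, k). p m * p k * q ^ k) ?A * \<zeta> powi n"
      by (simp add: case_prod_unfold infsum_cmult_left')
    finally show "((\<lambda>y. case (n, y) of (n, mk) \<Rightarrow> ?f mk) has_sum
       infsum (\<lambda>(m, k). p m * p k * q ^ k) ?A * \<zeta> powi n) ?A"
      by simp
  qed
qed

text \<open>The residue theorem on a rectangle of width one: the vertical sides cancel by
  periodicity, and the top side is traversed backwards, hence the minus sign.\<close>

lemma periodic_strip_residue:
  fixes F :: "complex \<Rightarrow> complex"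
  assumes holo: "F holomorphic_on box (Complex (- 1) (- v)) (Complex 1 v) - {0}"
    and per: "\<And>z. F (z + 1) = F z"
    and y: "- v < y1" "y1 < 0" "0 < y2" "y2 < v"
    and bot: "(F has_contour_integral I1) (linepath (Complex (- 1 / 2) y1) (Complex (1 / 2) y1))"
    and top: "(F has_contour_integral I2) (linepath (Complex (- 1 / 2) y2) (Complex (1 / 2) y2))"
  shows "I1 - I2 = 2 * of_real pi * \<i> * residue F 0"
proof -
  let ?a = "Complex (- 1 / 2) y1" and ?b = "Complex (1 / 2) y1"
  let ?c = "Complex (1 / 2) y2" and ?d = "Complex (- 1 / 2) y2"
  let ?S = "box (Complex (- 1) (- v)) (Complex 1 v)"
  let ?g = "rectpath ?a ?c"
  have 0: "0 \<in> box ?a ?c"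
    using y by (simp add: in_box_complex_iff)
  have cbox: "cbox ?a ?c \<subseteq> ?S"
    using y by (auto simp: in_box_complex_iff in_cbox_complex_iff)
  have img: "path_image ?g \<subseteq> ?S - {0}"
    using path_image_rectpath_cbox_minus_box[of ?a ?c] 0 cbox y by auto
  have "contour_integral ?g F = 2 * pi * \<i> * (\<Sum>p\<in>{0}. winding_number ?g p * residue F p)"
  proof (rule Residue_theorem[of ?S])
    show "\<forall>z. z \<notin> ?S \<longrightarrow> winding_number ?g z = 0"
      using cbox y by (auto intro!: winding_number_rectpath_outside)
  qed (use img holo in \<open>auto intro: convex_connected\<close>)
  then have res: "contour_integral ?g F = 2 * of_real pi * \<i> * residue F 0"
    using winding_number_rectpath[OF 0] by simp
  have seg: "path_image (linepath ?b ?c) \<subseteq> path_image ?g" "path_image (linepath ?d ?a) \<subseteq> path_image ?g"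
    by (auto simp: rectpath_def Let_def path_image_join)
  have int: "F contour_integrable_on p" if "path_image p \<subseteq> path_image ?g" "p = linepath u w" for p u w
    using that img unfolding that(2)
    by (intro contour_integrable_continuous_linepath continuous_on_subset[OF holomorphic_on_imp_continuous_on[OF holo]]) auto
  obtain J where J: "(F has_contour_integral J) (linepath ?b ?c)"
    using int[OF seg(1)] by (auto simp: contour_integrable_on_def)
  have "(F has_contour_integral J) (linepath ?a ?d)"
  proof -
    have "linepath ?b ?c = (+) 1 \<circ> linepath ?a ?d"
      by (auto simp: linepath_def fun_eq_iff complex_eq_iff algebra_simps)
    then have "linepath ?b ?c x = linepath ?a ?d x + 1" for x
      by (simp add: add.commute)
    moreover have "?c - ?b = ?d - ?a"
      by (simp add: complex_eq_iff)
    ultimately show ?thesis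
      using J by (simp add: has_contour_integral_linepath per)
  qed
  then have left: "(F has_contour_integral (- J)) (linepath ?d ?a)"
    using has_contour_integral_reversepath[of "linepath ?a ?d"] by simp
  have "(F has_contour_integral (- I2)) (linepath ?c ?d)"
    using has_contour_integral_reversepath[OF _ top] by simp
  moreover have "?g = linepath ?a ?b +++ linepath ?b ?c +++ linepath ?c ?d +++ linepath ?d ?a"
    by (simp add: rectpath_def Let_def)
  ultimately have "(F has_contour_integral (I1 + (J + (- I2 + - J)))) ?g"
    by (simp only:) (intro has_contour_integral_join bot J left valid_path_join valid_path_linepath; simp)
  then show ?thesis
    using res contour_integral_unique by fastforce
qed

section \<open>Principal parts\<close>

text \<open>Induction on the pole order: subtracting \<open>H 0\<close> and dividing by z, with the
  removable singularity filled in, lowers the order by one. The factor \<open>c ^ Suc l\<close> in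
  the top coefficient compensates for expanding in c z.\<close>

lemma principal_part_exists:
  fixes c :: complex
  assumes "open S" "0 \<in> S" "H holomorphic_on S" "c \<noteq> 0"
  shows "\<exists>D h. (\<forall>j. j \<notin> {1..l} \<longrightarrow> D j = 0) \<and> h holomorphic_on S \<and>
    (\<forall>z\<in>S - {0}. H z / z ^ l = (\<Sum>j = 1..l. D j / (c * z) ^ j) + h z)"
  using assms(3)
proof (induction l arbitrary: H)
  case 0
  then show ?case
    by (intro exI[of _ "\<lambda>_. 0"] exI[of _ H]) auto
next
  case (Suc l)
  define H1 where "H1 = (\<lambda>z. if z = 0 then deriv H 0 else (H z - H 0) / (z - 0))"
  have "H1 holomorphic_on S"
    unfolding H1_def using Suc.prems assms(1) by (rule pole_lemma_open)
  from Suc.IH[OF this] obtain D h where D: "\<forall>j. j \<notin> {1..l} \<longrightarrow> D j = 0" and h: "h holomorphic_on S"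
    and eq: "\<forall>z\<in>S - {0}. H1 z / z ^ l = (\<Sum>j = 1..l. D j / (c * z) ^ j) + h z"
    by blast
  let ?D = "D(Suc l := H 0 * c ^ Suc l)"
  have "H z / z ^ Suc l = (\<Sum>j = 1..Suc l. ?D j / (c * z) ^ j) + h z" if z: "z \<in> S - {0}" for z
  proof -
    have "H z = H 0 + z * H1 z"
      using z by (simp add: H1_def)
    then have "H z / z ^ Suc l = H 0 / z ^ Suc l + H1 z / z ^ l"
      using z by (simp add: divide_simps)
    also have "H1 z / z ^ l = (\<Sum>j = 1..l. ?D j / (c * z) ^ j) + h z"
      using eq z by simp
    also have "H 0 / z ^ Suc l = ?D (Suc l) / (c * z) ^ Suc l"
      using assms(4) by (simp add: power_mult_distrib)
    finally show ?thesis
      by (simp add: algebra_simps)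
  qed
  then show ?case
    using D h by (intro exI[of _ ?D] exI[of _ h]) auto
qed

text \<open>Multiplied by (c z)^(l+1), a bounded principal part of order l + 1 tends to 0, yet the
  limit is also its leading coefficient. The others follow by descent.\<close>

lemma principal_part_bounded_imp_zero:
  fixes c :: complex
  assumes "c \<noteq> 0" "(\<lambda>z. \<Sum>j = 1..l. D j / (c * z) ^ j) \<in> O[at 0](\<lambda>_. 1)" "j \<in> {1..l}"
  shows "D j = 0"
  using assms(2,3)
proof (induction l)
  case (Suc l)
  let ?f = "\<lambda>z. \<Sum>j = 1..Suc l. D j / (c * z) ^ j"
  have lim0: "((\<lambda>z. (c * z) ^ Suc l) \<longlongrightarrow> 0) (at 0)"
    by (auto intro!: tendsto_eq_intros)
  have "(\<lambda>z. ?f z * (c * z) ^ Suc l) \<in> o[at 0](\<lambda>z. 1 * 1)"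
    using Suc.prems(1) by (rule landau_o.big_small_mult) (rule smalloI_tendsto, use lim0 in auto)
  then have lim1: "((\<lambda>z. ?f z * (c * z) ^ Suc l) \<longlongrightarrow> 0) (at 0)"
    by (auto dest: smalloD_tendsto)
  have "((\<lambda>z. \<Sum>j = 1..Suc l. D j * (c * z) ^ (Suc l - j)) \<longlongrightarrow>
      (\<Sum>j = 1..Suc l. D j * (c * 0) ^ (Suc l - j))) (at 0)"
    by (intro tendsto_intros)
  also have "(\<Sum>j = 1..Suc l. D j * (c * 0) ^ (Suc l - j)) = D (Suc l)"
    by (simp add: power_0_left sum.neutral)
  also have "((\<lambda>z. \<Sum>j = 1..Suc l. D j * (c * z) ^ (Suc l - j)) \<longlongrightarrow> D (Suc l)) (at 0) \<longleftrightarrow>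
      ((\<lambda>z. ?f z * (c * z) ^ Suc l) \<longlongrightarrow> D (Suc l)) (at 0)"
  proof (rule filterlim_cong[OF refl refl])
    have "\<forall>\<^sub>F z in at 0. z \<noteq> (0 :: complex)"
      by (rule eventually_neq_at_within)
    then show "\<forall>\<^sub>F z in at 0. (\<Sum>j = 1..Suc l. D j * (c * z) ^ (Suc l - j)) = ?f z * (c * z) ^ Suc l"
    proof eventually_elim
      case (elim z)
      then have "c * z \<noteq> 0"
        using assms(1) by simp
      then have "D j * (c * z) ^ (Suc l - j) = D j / (c * z) ^ j * (c * z) ^ Suc l"
        if "j \<in> {1..Suc l}" for j
        using that by (simp add: power_diff del: power_Suc)
      then show ?case
        unfolding sum_distrib_right by (intro sum.cong refl)
    qed
  qed
  finally have D: "D (Suc l) = 0"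
    using lim1 tendsto_unique[OF at_neq_bot] by blast
  show ?case
  proof (cases "j = Suc l")
    case False
    then show ?thesis
      using Suc D by simp
  qed (use D in simp)
qed auto

text \<open>The difference of two admissible principal parts is a bounded principal part and
  therefore vanishes.\<close>

lemma D_coeff_eqI:
  assumes "\<And>j. j \<notin> {1..l} \<Longrightarrow> D j = 0"
    and "(\<lambda>z. g_fun l z \<tau> - (\<Sum>j = 1..l. D j / (2 * of_real pi * \<i> * z) ^ j)) \<in> O[at 0](\<lambda>_. 1)"
  shows "D_coeff l \<tau> = D"
  unfolding D_coeff_def
proof (rule the_equality, intro conjI allI impI)
  fix E
  let ?p = "\<lambda>D z. \<Sum>j = 1..l. D j / (2 * of_real pi * \<i> * z) ^ j"
  assume E: "(\<forall>j. j \<notin> {1..l} \<longrightarrow> E j = 0) \<and> (\<lambda>z. g_fun l z \<tau> - ?p E z) \<in> O[at 0](\<lambda>_. 1)"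
  have "(\<lambda>z. (g_fun l z \<tau> - ?p D z) - (g_fun l z \<tau> - ?p E z)) \<in> O[at 0](\<lambda>_. 1)"
    by (rule sum_in_bigo(2)[OF assms(2) conjunct2[OF E]])
  also have "(\<lambda>z. (g_fun l z \<tau> - ?p D z) - (g_fun l z \<tau> - ?p E z)) = ?p (\<lambda>j. E j - D j)"
    by (simp add: fun_eq_iff diff_divide_distrib sum_subtractf)
  finally have "E j - D j = 0" if "j \<in> {1..l}" for j
    using principal_part_bounded_imp_zero[of "2 * of_real pi * \<i>" "\<lambda>j. E j - D j" l] that by simp
  then show "E = D"
    using assms(1) E by (metis eq_iff_diff_eq_0 ext)
qed (use assms in auto)

section \<open>Residue of a principal part times an exponential\<close>

lemma higher_deriv_exp_mult:
  fixes a :: complex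
  shows "(deriv ^^ k) (\<lambda>z. exp (a * z)) = (\<lambda>z. a ^ k * exp (a * z))"
proof (induction k)
  case (Suc k)
  have "deriv (\<lambda>z. a ^ k * exp (a * z)) z = a ^ Suc k * exp (a * z)" for z
    by (rule DERIV_imp_deriv) (auto intro!: derivative_eq_intros)
  then show ?case
    by (simp add: Suc)
qed auto

text \<open>On a small circle Cauchy's formula turns each pole into a derivative of exp(a z) at 0,
  while h(z) exp(a z) contributes nothing.\<close>

lemma residue_principal_part_exp:
  fixes a c :: complex
  assumes S: "open S" "0 \<in> S" and h: "h holomorphic_on S"
    and F: "\<And>z. z \<in> S - {0} \<Longrightarrow> F z = ((\<Sum>j = 1..l. D j / (c * z) ^ j) + h z) * exp (a * z)"
    and c: "c \<noteq> 0"
  shows "residue F 0 = (\<Sum>j = 1..l. D j / c ^ j * (a ^ (j - 1) / fact (j - 1)))"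
proof -
  obtain e where e: "e > 0" "cball 0 e \<subseteq> S"
    using S open_contains_cball by blast
  let ?\<gamma> = "circlepath 0 e"
  have img: "path_image ?\<gamma> \<subseteq> S - {0}"
    using e by (auto simp: path_image_circlepath)
  have "F holomorphic_on S - {0}"
    by (rule holomorphic_transform[of "\<lambda>z. ((\<Sum>j = 1..l. D j / (c * z) ^ j) + h z) * exp (a * z)"])
       (use F c h in \<open>auto intro!: holomorphic_intros intro: holomorphic_on_subset\<close>)
  then have "(F has_contour_integral 2 * pi * \<i> * residue F 0) ?\<gamma>"
    using S e by (intro base_residue) auto
  moreover have "((\<lambda>z. (\<Sum>j = 1..l. D j / c ^ j * (exp (a * z) / (z - 0) ^ Suc (j - 1))) + h z * exp (a * z))
      has_contour_integral (\<Sum>j = 1..l. D j / c ^ j * (2 * pi * \<i> / fact (j - 1) * a ^ (j - 1))) + 0) ?\<gamma>"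
  proof (intro has_contour_integral_add has_contour_integral_sum has_contour_integral_lmul)
    fix j
    have "((\<lambda>z. exp (a * z) / (z - 0) ^ Suc (j - 1)) has_contour_integral
        2 * pi * \<i> / fact (j - 1) * (deriv ^^ (j - 1)) (\<lambda>z. exp (a * z)) 0) ?\<gamma>"
      by (rule Cauchy_has_contour_integral_higher_derivative_circlepath)
         (use e in \<open>auto intro!: continuous_intros holomorphic_intros\<close>)
    then show "((\<lambda>z. exp (a * z) / (z - 0) ^ Suc (j - 1)) has_contour_integral
        2 * pi * \<i> / fact (j - 1) * a ^ (j - 1)) ?\<gamma>"
      by (simp add: higher_deriv_exp_mult)
  next
    have "(\<lambda>z. h z * exp (a * z)) holomorphic_on cball 0 e"
      using h e(2) by (auto intro!: holomorphic_intros intro: holomorphic_on_subset)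
    then show "((\<lambda>z. h z * exp (a * z)) has_contour_integral 0) ?\<gamma>"
      by (rule Cauchy_theorem_convex_simple) (use e in \<open>auto simp: path_image_circlepath\<close>)
  qed auto
  then have "(F has_contour_integral
      (\<Sum>j = 1..l. D j / c ^ j * (2 * pi * \<i> / fact (j - 1) * a ^ (j - 1))) + 0) ?\<gamma>"
  proof (rule has_contour_integral_eq)
    fix z assume "z \<in> path_image ?\<gamma>"
    then have z: "z \<in> S - {0}"
      using img by blast
    have "D j / c ^ j * (exp (a * z) / (z - 0) ^ Suc (j - 1)) = D j / (c * z) ^ j * exp (a * z)"
      if "j \<in> {1..l}" for j
      using that by (cases j) (auto simp: power_mult_distrib)
    then show "(\<Sum>j = 1..l. D j / c ^ j * (exp (a * z) / (z - 0) ^ Suc (j - 1))) + h z * exp (a * z) = F z"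
      unfolding F[OF z] distrib_right sum_distrib_right
      by (intro arg_cong2[of _ _ _ _ "(+)"] sum.cong refl)
  qed
  ultimately have "2 * pi * \<i> * residue F 0 =
      (\<Sum>j = 1..l. D j / c ^ j * (2 * pi * \<i> / fact (j - 1) * a ^ (j - 1)))"
    using has_contour_integral_unique by fastforce
  also have "\<dots> = 2 * pi * \<i> * (\<Sum>j = 1..l. D j / c ^ j * (a ^ (j - 1) / fact (j - 1)))"
    unfolding sum_distrib_left by (intro sum.cong) (auto simp: field_simps)
  finally show ?thesis
    by simp
qed

section \<open>Product formulas for theta and its quotient\<close>

lemma norm_nome_less_one: "Im \<tau> > 0 \<Longrightarrow> norm (nome \<tau>) < 1"
  by (simp add: norm_nome)

lemma qpow_add: "qpow \<tau> (a + b) = qpow \<tau> a * qpow \<tau> b"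
  by (simp add: qpow_def exp_add distrib_left)

lemma qpow_of_int: "qpow \<tau> (of_int n) = nome \<tau> powi n"
  by (simp add: qpow_def exp_power_int mult_ac)

lemma norm_qpow: "norm (qpow \<tau> r) = exp (- 2 * pi * Im \<tau> * r)"
  by (simp add: qpow_def norm_exp_eq_Re)

text \<open>Write the half-integer as m - 1/2: half its square is m (m - 1) / 2 + 1/8 and exp(pi i
  (m - 1/2)) is - i (-1)^m, which brings the series into the form of the triple product.\<close>

lemma jacobi_theta_product:
  assumes "Im \<tau> > 0"
  shows "jacobi_theta z \<tau> = - \<i> * qpow \<tau> (1 / 8) * exp (- (of_real pi * \<i> * z)) *
    (qpoch_inf (nome \<tau>) (nome \<tau>) * qpoch_inf (nome z) (nome \<tau>) *
      qpoch_inf (nome \<tau> / nome z) (nome \<tau>))"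
proof -
  let ?q = "nome \<tau>" and ?w = "nome z"
  let ?C = "- \<i> * qpow \<tau> (1 / 8) * exp (- (of_real pi * \<i> * z))"
  have "jacobi_theta z \<tau> = (\<Sum>\<^sub>\<infinity>m. ?C * (?q powi (m * (m - 1) div 2) * (- ?w) powi m))"
    unfolding jacobi_theta_def
  proof (rule infsum_reindex_bij_witness[of _ "\<lambda>m. m - 1" "\<lambda>n. n + 1"])
    fix n :: int
    let ?m = "n + 1"
    have "2 * (?m * (?m - 1) div 2) = ?m * n"
      by simp
    then have "2 * (of_int (?m * (?m - 1) div 2) :: complex) = of_int ?m * of_int n"
      by (metis of_int_mult of_int_numeral)
    moreover have "x = y / 2" if "2 * x = y" for x y :: complex
      using that by auto
    ultimately have e: "(of_int (?m * (?m - 1) div 2) :: complex) = of_int ?m * of_int n / 2"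
      by blast
    have "exp (\<i> * of_real pi / 2) = \<i>"
      using cis_conv_exp[of "pi / 2"] by simp
    then have "- \<i> = exp (- (\<i> * of_real pi / 2))"
      by (simp add: exp_minus)
    moreover have "- ?w = exp (\<i> * of_real pi + 2 * of_real pi * \<i> * z)"
      by (simp add: exp_add)
    ultimately show "?C * (?q powi (?m * (?m - 1) div 2) * (- ?w) powi ?m) =
      qpow \<tau> ((of_int n + 1 / 2)\<^sup>2 / 2) * exp (2 * of_real pi * \<i> * (of_int n + 1 / 2) * (z + 1 / 2))"
      by (simp only: qpow_def exp_power_int exp_add [symmetric] e, intro arg_cong[of _ _ exp])
         (simp add: field_simps power2_eq_square)
  qed auto
  also have "\<dots> = ?C * (\<Sum>\<^sub>\<infinity>m. ?q powi (m * (m - 1) div 2) * (- ?w) powi m)"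
    by (rule infsum_cmult_right')
  also have "(\<Sum>\<^sub>\<infinity>m. ?q powi (m * (m - 1) div 2) * (- ?w) powi m) =
      qpoch_inf ?q ?q * qpoch_inf ?w ?q * qpoch_inf (?q / ?w) ?q"
    by (intro infsumI jacobi_triple_product) (use norm_nome_less_one[OF assms] in auto)
  finally show ?thesis .
qed

text \<open>With e = exp(pi i z), pulling out the first factor 1 - e^2 leaves a product symmetric
  under e -> 1/e, times 1/e - e, which changes sign.\<close>

lemma jacobi_theta_uminus:
  assumes "Im \<tau> > 0"
  shows "jacobi_theta (- z) \<tau> = - jacobi_theta z \<tau>"
proof -
  let ?q = "nome \<tau>"
  define e where "e = exp (of_real pi * \<i> * z)"
  have e: "e \<noteq> 0" "nome z = e * e" "nome (- z) = 1 / (e * e)"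
    "exp (- (of_real pi * \<i> * z)) = 1 / e" "exp (- (of_real pi * \<i> * - z)) = e"
    by (simp_all add: e_def exp_add [symmetric] exp_minus field_simps)
  have q: "qpoch_inf (e * e) ?q = (1 - e * e) * qpoch_inf (e * e * ?q) ?q"
    "qpoch_inf (1 / (e * e)) ?q = (1 - 1 / (e * e)) * qpoch_inf (?q / (e * e)) ?q"
    using qpoch_inf_rec[OF norm_nome_less_one[OF assms], of "e * e"]
      qpoch_inf_rec[OF norm_nome_less_one[OF assms], of "1 / (e * e)"] by simp_all
  have q': "?q / (1 / (e * e)) = e * e * ?q"
    by simp
  show ?thesis
    unfolding jacobi_theta_product[OF assms] e(2-5) q q' using e(1) by (simp add: field_simps)
qed

text \<open>Shifting w to q w trades the factor 1 - w for 1 - 1/w, and 1 - w = - w (1 -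
  1/w).\<close>

lemma qpoch_product_shift:
  fixes q w :: complex
  assumes "norm q < 1" "q \<noteq> 0" "w \<noteq> 0"
  shows "qpoch_inf w q * qpoch_inf (q / w) q = - w * (qpoch_inf (q * w) q * qpoch_inf (q / (q * w)) q)"
proof -
  have 1: "qpoch_inf w q = (1 - w) * qpoch_inf (q * w) q"
    using qpoch_inf_rec[OF assms(1), of w] by (simp add: mult.commute)
  have 2: "qpoch_inf (1 / w) q = (1 - 1 / w) * qpoch_inf (q / w) q"
    using qpoch_inf_rec[OF assms(1), of "1 / w"] by simp
  have 3: "q / (q * w) = 1 / w"
    using assms by simp
  show ?thesis
    unfolding 1 2 3 using assms by (simp add: field_simps)
qed

text \<open>The cube of \<open>dedekind_eta\<close> carries q^(1/8), which cancels the same factor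
  of theta.\<close>

lemma g_fun_product:
  assumes "Im \<tau> > 0"
  shows "g_fun l z \<tau> = \<i> ^ l * qpoch_inf (nome \<tau>) (nome \<tau>) ^ (2 * l) * exp (of_nat l * of_real pi * \<i> * z) /
    (qpoch_inf (nome z) (nome \<tau>) * qpoch_inf (nome \<tau> / nome z) (nome \<tau>)) ^ l"
proof -
  let ?P = "qpoch_inf (nome \<tau>) (nome \<tau>)"
  let ?X = "qpoch_inf (nome z) (nome \<tau>) * qpoch_inf (nome \<tau> / nome z) (nome \<tau>)"
  have P: "?P \<noteq> 0"
    using qpoch_inf_nonzero norm_nome_less_one[OF assms] by blast
  have Q: "qpow \<tau> (1 / 24) ^ 3 = qpow \<tau> (1 / 8)" "qpow \<tau> (1 / 8) \<noteq> 0"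
    by (simp_all add: qpow_def exp_of_nat_mult [symmetric])
  have "dedekind_eta \<tau> ^ 3 / jacobi_theta z \<tau> = \<i> * ?P\<^sup>2 * exp (of_real pi * \<i> * z) / ?X"
  proof -
    \<comment> \<open>Where theta vanishes, x y = 0 and both sides are 0 by the convention for
      division, so the product formula holds at every z.\<close>
    have *: "Q * P ^ 3 / (k' * Q * inverse e * (P * x * y)) = k * P\<^sup>2 * e / (x * y)"
      if "Q \<noteq> 0" "P \<noteq> 0" "e \<noteq> 0" "k * k' = 1" for Q P k k' e x y :: complex
    proof -
      have k: "k \<noteq> 0"
        using that(4) by auto
      then have k': "k' = 1 / k"
        using that(4) by (simp add: field_simps)
      show ?thesis
        unfolding k' using k that(1-3) by (simp add: field_simps power2_eq_square power3_eq_cube)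
    qed
    show ?thesis
      unfolding jacobi_theta_product[OF assms] dedekind_eta_def power_mult_distrib Q(1) exp_minus
      by (rule *) (use P Q(2) in auto)
  qed
  moreover have "g_fun l z \<tau> = (dedekind_eta \<tau> ^ 3 / jacobi_theta z \<tau>) ^ l"
    by (simp add: g_fun_def power_mult power_divide)
  ultimately have "g_fun l z \<tau> = (\<i> * ?P\<^sup>2 * exp (of_real pi * \<i> * z) / ?X) ^ l"
    by (simp only:)
  moreover have "exp (of_nat l * of_real pi * \<i> * z) = exp (of_real pi * \<i> * z) ^ l"
    by (simp add: exp_of_nat_mult [symmetric] mult_ac)
  ultimately show ?thesis
    by (simp only: power_divide power_mult_distrib power_mult)
qed

lemma g_fun_uminus:
  assumes "Im \<tau> > 0"
  shows "g_fun l (- z) \<tau> = (- 1) ^ l * g_fun l z \<tau>"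
  by (cases "even l") (simp_all add: g_fun_def jacobi_theta_uminus[OF assms])

section \<open>The Laurent expansion of the theta quotient at zero\<close>

text \<open>The box is wider than one period so that it is an open neighbourhood of the closed rectangle
  of width 1 around 0; the zeros of theta it contains reduce to 0 all the same.\<close>

abbreviation fundamental_box :: "complex \<Rightarrow> complex set" where
  "fundamental_box \<tau> \<equiv> box (Complex (- 1) (- Im \<tau>)) (Complex 1 (Im \<tau>))"

lemma nome_eq_one_imp_zero:
  assumes "z \<in> fundamental_box \<tau>" "nome z = 1"
  shows "z = 0"
proof -
  from assms(2) obtain n :: int where "Im z = 0" "2 * pi * Re z = of_int (2 * n) * pi"
    by (auto simp: exp_eq_1)
  moreover from this have "Re z = of_int n"
    by simp
  moreover from this assms(1) have "n = 0"
    by (auto simp: in_box_complex_iff)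
  ultimately show ?thesis
    by (simp add: complex_eq_iff)
qed

text \<open>The arguments are \<open>nome (z + \<tau>)\<close> and \<open>nome (\<tau> - z)\<close>,
  of norm below 1 because |Im z| < Im \<tau> in the box.\<close>

lemma qpoch_nome_nonzero:
  assumes "Im \<tau> > 0" "z \<in> fundamental_box \<tau>"
  shows "qpoch_inf (nome z * nome \<tau>) (nome \<tau>) \<noteq> 0" "qpoch_inf (nome \<tau> / nome z) (nome \<tau>) \<noteq> 0"
proof -
  have "norm (nome z * nome \<tau>) < 1" "norm (nome \<tau> / nome z) < 1"
    using assms norm_nome_less_one[of "z + \<tau>"] norm_nome_less_one[of "\<tau> - z"]
    by (simp_all add: in_box_complex_iff distrib_left right_diff_distrib exp_add exp_diff)
  then show "qpoch_inf (nome z * nome \<tau>) (nome \<tau>) \<noteq> 0" "qpoch_inf (nome \<tau> / nome z) (nome \<tau>) \<noteq> 0"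
    using qpoch_inf_nonzero norm_nome_less_one[OF assms(1)] by blast+
qed

text \<open>In the box the denominator of the product formula vanishes only through 1 - nome z at 0.
  This zero is simple: 1 - nome z = z E(z) with E zero-free.\<close>

lemma g_fun_pole:
  assumes "Im \<tau> > 0"
  obtains H where "H holomorphic_on fundamental_box \<tau>"
    "\<And>z. z \<in> fundamental_box \<tau> - {0} \<Longrightarrow> g_fun l z \<tau> = H z / z ^ l"
proof -
  let ?U = "fundamental_box \<tau>" and ?q = "nome \<tau>"
  note q1 = norm_nome_less_one[OF assms]
  \<comment> \<open>The subtracted \<open>1 - nome 0\<close> is 0; it gives the quotient the shape
    required by \<open>pole_lemma_open\<close>.\<close>
  define E where "E = (\<lambda>z. if z = 0 then deriv (\<lambda>z. 1 - nome z) 0 else (1 - nome z - (1 - nome 0)) / (z - 0))"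
  have E_holo: "E holomorphic_on ?U"
    unfolding E_def by (rule pole_lemma_open) (auto intro!: holomorphic_intros)
  have "deriv (\<lambda>z. 1 - nome z) 0 = - (2 * of_real pi * \<i>)"
    by (rule DERIV_imp_deriv) (auto intro!: derivative_eq_intros)
  then have E_nz: "E z \<noteq> 0" if "z \<in> ?U" for z
    using nome_eq_one_imp_zero[OF that] by (auto simp: E_def)
  define H where "H = (\<lambda>z. \<i> ^ l * qpoch_inf ?q ?q ^ (2 * l) * exp (of_nat l * of_real pi * \<i> * z) /
    (E z * qpoch_inf (nome z * ?q) ?q * qpoch_inf (?q / nome z) ?q) ^ l)"
  have comp: "(\<lambda>z. qpoch_inf (f z) ?q) holomorphic_on A" if "f holomorphic_on A" for f A
    using holomorphic_on_compose[OF that holomorphic_on_qpoch_inf[OF q1]] by (simp add: o_def)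
  show ?thesis
  proof
    show "H holomorphic_on ?U"
      unfolding H_def
      by (intro holomorphic_intros comp E_holo) (use E_nz qpoch_nome_nonzero[OF assms] in auto)
  next
    fix z assume z: "z \<in> ?U - {0}"
    have "qpoch_inf (nome z) ?q = z * E z * qpoch_inf (nome z * ?q) ?q"
      using qpoch_inf_rec[OF q1, of "nome z"] z by (simp add: E_def)
    then show "g_fun l z \<tau> = H z / z ^ l"
      unfolding g_fun_product[OF assms] H_def by (simp add: power_mult_distrib mult_ac)
  qed
qed

text \<open>Existence and uniqueness together identify \<open>D_coeff\<close>. The exact
  decomposition on the whole box serves the contour argument, the O(1) form the parity
  argument.\<close>

lemma g_fun_principal_part:
  assumes "Im \<tau> > 0"
  obtains h where "h holomorphic_on fundamental_box \<tau>"
    "\<And>z. z \<in> fundamental_box \<tau> - {0} \<Longrightarrow>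
      g_fun l z \<tau> = (\<Sum>j = 1..l. D_coeff l \<tau> j / (2 * of_real pi * \<i> * z) ^ j) + h z"
    "(\<lambda>z. g_fun l z \<tau> - (\<Sum>j = 1..l. D_coeff l \<tau> j / (2 * of_real pi * \<i> * z) ^ j)) \<in> O[at 0](\<lambda>_. 1)"
    "\<And>j. j \<notin> {1..l} \<Longrightarrow> D_coeff l \<tau> j = 0"
proof -
  let ?U = "fundamental_box \<tau>"
  obtain H where H: "H holomorphic_on ?U" "\<And>z. z \<in> ?U - {0} \<Longrightarrow> g_fun l z \<tau> = H z / z ^ l"
    using g_fun_pole[OF assms] by blast
  have U: "open ?U" "0 \<in> ?U"
    using assms by (auto simp: in_box_complex_iff)
  obtain D h where D: "\<forall>j. j \<notin> {1..l} \<longrightarrow> D j = 0" and h: "h holomorphic_on ?U"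
    and eq: "\<forall>z\<in>?U - {0}. H z / z ^ l = (\<Sum>j = 1..l. D j / (2 * of_real pi * \<i> * z) ^ j) + h z"
    using principal_part_exists[OF U H(1), of "2 * of_real pi * \<i>" l] by auto
  let ?p = "\<lambda>z. \<Sum>j = 1..l. D j / (2 * of_real pi * \<i> * z) ^ j"
  have "(h \<longlongrightarrow> h 0) (at 0)"
    using holomorphic_on_imp_continuous_on[OF h] U continuous_on_eq_continuous_at
    by (auto simp: isCont_def)
  then have "h \<in> O[at 0](\<lambda>_. 1)"
    by (intro bigoI_tendsto[of _ _ "h 0"]) auto
  also have "h \<in> O[at 0](\<lambda>_. 1) \<longleftrightarrow> (\<lambda>z. g_fun l z \<tau> - ?p z) \<in> O[at 0](\<lambda>_. 1)"
  proof (rule landau_o.big.in_cong)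
    have "\<forall>\<^sub>F z in at 0. z \<in> ?U - {0}"
      using U eventually_at_in_open by blast
    then show "\<forall>\<^sub>F z in at 0. h z = g_fun l z \<tau> - ?p z"
      by eventually_elim (use eq H(2) in simp)
  qed
  finally have O: "(\<lambda>z. g_fun l z \<tau> - ?p z) \<in> O[at 0](\<lambda>_. 1)" .
  have "D_coeff l \<tau> = D"
    by (rule D_coeff_eqI) (use D O in auto)
  with D O h eq H(2) that[of h] show ?thesis
    by simp
qed

text \<open>Since \<open>g_fun\<close> has the parity of l in z, the numbers (-1)^(l+j) D_j form
  another admissible principal part; uniqueness gives D_j = - D_j when l + j is odd.\<close>

lemma D_coeff_parity:
  assumes "Im \<tau> > 0" "j mod 2 \<noteq> l mod 2"
  shows "D_coeff l \<tau> j = 0"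
proof -
  let ?D = "D_coeff l \<tau>"
  let ?p = "\<lambda>D z. \<Sum>j = 1..l. D j / (2 * of_real pi * \<i> * z) ^ j"
  define E where "E j = (- 1) ^ (l + j) * ?D j" for j
  obtain h where O: "(\<lambda>z. g_fun l z \<tau> - ?p ?D z) \<in> O[at 0](\<lambda>_. 1)" and D: "\<And>j. j \<notin> {1..l} \<Longrightarrow> ?D j = 0"
    using g_fun_principal_part[OF assms(1), of l] by blast
  have "filterlim uminus (at 0) (at (0 :: complex))"
    by (rule filterlim_atI) (auto intro!: tendsto_eq_intros simp: eventually_at_filter)
  from landau_o.big.compose[OF O this]
  have "(\<lambda>z. (- 1) ^ l * (g_fun l (- z) \<tau> - ?p ?D (- z))) \<in> O[at 0](\<lambda>_. 1)"
    by simp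
  also have "(\<lambda>z. (- 1) ^ l * (g_fun l (- z) \<tau> - ?p ?D (- z))) = (\<lambda>z. g_fun l z \<tau> - ?p E z)"
  proof
    fix z
    have "(- 1) ^ l * (?D j / (2 * of_real pi * \<i> * - z) ^ j) = E j / (2 * of_real pi * \<i> * z) ^ j" for j
      by (cases "even j") (auto simp: E_def power_add)
    then show "(- 1) ^ l * (g_fun l (- z) \<tau> - ?p ?D (- z)) = g_fun l z \<tau> - ?p E z"
      by (simp add: g_fun_uminus[OF assms(1)] right_diff_distrib sum_distrib_left
          flip: power_mult_distrib mult.assoc)
  qed
  finally have "?D = E"
    by (intro D_coeff_eqI) (use D in \<open>auto simp: E_def\<close>)
  then have "?D j = (- 1) ^ (l + j) * ?D j"
    unfolding E_def by metis
  moreover have "odd (l + j)"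
    using assms(2) by presburger
  ultimately show ?thesis
    by simp
qed

section \<open>Recursion for the Laurent coefficients\<close>

text \<open>The generating function in \<open>F_fun\<close> stripped of its powers of
  \<open>qpoch_inf q q\<close>, which are restored in the final theorem.\<close>

definition theta_quot :: "nat \<Rightarrow> complex \<Rightarrow> complex \<Rightarrow> complex" where
  "theta_quot l q w = 1 / (qpoch_inf w q * qpoch_inf (q / w) q) ^ l"

text \<open>The quotient factors as \<open>\<phi> w * \<phi> (q / w)\<close> with \<phi> holomorphic
  on the unit disc.\<close>

lemma theta_quot_laurent:
  assumes "norm q < 1"
  obtains a where "\<And>w. norm q < norm w \<Longrightarrow> norm w < 1 \<Longrightarrow> ((\<lambda>n. a n * w powi n) has_sum theta_quot l q w) UNIV"
proof -
  define \<phi> where "\<phi> = (\<lambda>w. 1 / qpoch_inf w q ^ l)"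
  have "\<phi> holomorphic_on ball 0 1"
    unfolding \<phi>_def by (intro holomorphic_intros holomorphic_on_qpoch_inf assms)
      (use qpoch_inf_nonzero[OF assms] in auto)
  define p where "p = (\<lambda>n. (deriv ^^ n) \<phi> 0 / fact n)"
  from \<open>\<phi> holomorphic_on ball 0 1\<close>
  have sums: "(\<lambda>n. p n * w ^ n) sums \<phi> w" if "norm w < 1" for w
    using holomorphic_power_series[of \<phi> 0 1 w] that by (simp add: p_def)
  have eq: "\<phi> w * \<phi> (q / w) = theta_quot l q w" for w
    by (simp add: \<phi>_def theta_quot_def power_mult_distrib)
  show ?thesis
  proof (rule that[of "\<lambda>n. \<Sum>\<^sub>\<infinity>(m, k)\<in>{(m, k). int m - int k = n}. p m * p k * q ^ k"])
    fix w :: complex assume w: "norm q < norm w" "norm w < 1"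
    show "((\<lambda>n. (\<Sum>\<^sub>\<infinity>(m, k)\<in>{(m, k). int m - int k = n}. p m * p k * q ^ k) * w powi n)
        has_sum theta_quot l q w) UNIV"
      using has_sum_laurent_product[OF sums w] by (simp only: eq)
  qed
qed

text \<open>For w in the outer annulus q w lies in the inner one, and quasi-periodicity expresses
  the value at w as (-1/w)^l times that at q w; the factor w^(-l) shifts the index by l.\<close>

lemma theta_quot_laurent_outer:
  assumes q: "norm q < 1" "q \<noteq> 0"
    and a: "\<And>w. norm q < norm w \<Longrightarrow> norm w < 1 \<Longrightarrow> ((\<lambda>n. a n * w powi n) has_sum theta_quot l q w) UNIV"
    and w: "1 < norm w" "norm w < 1 / norm q"
  shows "((\<lambda>n. (- 1) ^ l * q powi (n + int l) * a (n + int l) * w powi n) has_sum theta_quot l q w) UNIV"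
proof -
  have w0: "w \<noteq> 0"
    using w by auto
  have "norm q < norm (q * w)" "norm (q * w) < 1"
    using q w by (auto simp: norm_mult field_simps)
  from has_sum_cmult_right[OF a[OF this], of "(- 1 / w) ^ l"]
  have "((\<lambda>n. (- 1 / w) ^ l * (a n * (q * w) powi n)) has_sum (- 1 / w) ^ l * theta_quot l q (q * w)) UNIV" .
  also have "(- 1 / w) ^ l * theta_quot l q (q * w) = theta_quot l q w"
    unfolding theta_quot_def qpoch_product_shift[OF q w0] using w0
    by (cases "even l") (simp_all add: power_mult_distrib power_divide)
  also have "((\<lambda>n. (- 1 / w) ^ l * (a n * (q * w) powi n)) has_sum theta_quot l q w) UNIV \<longleftrightarrow> ?thesis"
  proof (rule has_sum_reindex_bij_witness[of _ "\<lambda>n. n + int l" "\<lambda>n. n - int l"])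
    fix n :: int
    have "w powi n = w powi (n - int l) * w ^ l"
      using w0 power_int_add[of w "n - int l" "int l"] by simp
    then have "(- 1 / w) ^ l * (a n * (q * w) powi n) =
        ((- 1 / w) ^ l * w ^ l) * q powi n * a n * w powi (n - int l)"
      by (simp add: power_int_mult_distrib mult_ac)
    also have "(- 1 / w) ^ l * w ^ l = (- 1) ^ l"
      using w0 by (simp flip: power_mult_distrib)
    finally show "(- 1) ^ l * q powi (n - int l + int l) * a (n - int l + int l) * w powi (n - int l) =
        (- 1 / w) ^ l * (a n * (q * w) powi n)"
      unfolding diff_add_cancel by (rule sym)
  qed auto
  finally show ?thesis .
qed

lemma theta_quot_g_fun:
  assumes "Im \<tau> > 0"
  shows "theta_quot l (nome \<tau>) (nome z) =
    (- \<i>) ^ l / qpoch_inf (nome \<tau>) (nome \<tau>) ^ (2 * l) * exp (- (of_nat l * of_real pi * \<i> * z)) * g_fun l z \<tau>"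
proof -
  have P: "qpoch_inf (nome \<tau>) (nome \<tau>) ^ (2 * l) \<noteq> 0"
    using qpoch_inf_nonzero norm_nome_less_one[OF assms] by simp
  have i: "(- \<i>) ^ l * \<i> ^ l = 1"
    by (simp flip: power_mult_distrib)
  have *: "K / P * inverse e * (k * P * e / X) = 1 / X"
    if "P \<noteq> 0" "e \<noteq> 0" "K * k = 1" for K P e k X :: complex
  proof -
    have "K / P * inverse e * (k * P * e / X) = (K * k) / X"
      using that(1,2) by (simp add: field_simps)
    then show ?thesis
      using that(3) by simp
  qed
  show ?thesis
    unfolding theta_quot_def g_fun_product[OF assms] exp_minus
    by (rule *[symmetric, OF P exp_not_eq_zero i])
qed

text \<open>The two terms on the left are the integrals of \<open>?F\<close> along Im z = - y and Im
  z = y, so their difference is 2 pi i times the residue at 0.\<close>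

lemma theta_quot_coeff_rec:
  fixes a :: "int \<Rightarrow> complex" and \<tau> :: complex
  defines "q \<equiv> nome \<tau>"
  assumes \<tau>: "Im \<tau> > 0"
    and a: "\<And>w. norm q < norm w \<Longrightarrow> norm w < 1 \<Longrightarrow> ((\<lambda>n. a n * w powi n) has_sum theta_quot l q w) UNIV"
  shows "(- 1) ^ l * q powi (n + int l) * a (n + int l) - a n =
    (- \<i>) ^ l / qpoch_inf q q ^ (2 * l) *
      (\<Sum>j = 1..l. D_coeff l \<tau> j / fact (j - 1) * of_real (- (of_int n + real l / 2)) ^ (j - 1))"
proof -
  let ?F = "\<lambda>z. theta_quot l q (nome z) * exp (- 2 * of_real pi * \<i> * of_int n * z)"
  let ?U = "fundamental_box \<tau>"
  define K where "K = (- \<i>) ^ l / qpoch_inf q q ^ (2 * l)"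
  define c where "c = 2 * of_real pi * \<i>"
  \<comment> \<open>Half the height places the two circles at |q|^(1/2) and |q|^(-1/2), inside the
    inner and the outer annulus.\<close>
  define y where "y = Im \<tau> / 2"
  have q: "norm q < 1" "q \<noteq> 0"
    using norm_nome_less_one[OF \<tau>] by (auto simp: q_def)
  obtain h where h: "h holomorphic_on ?U"
    "\<And>z. z \<in> ?U - {0} \<Longrightarrow> g_fun l z \<tau> = (\<Sum>j = 1..l. D_coeff l \<tau> j / (c * z) ^ j) + h z"
    by (rule g_fun_principal_part[OF \<tau>, of l, folded c_def], rule that)
  \<comment> \<open>The exponent collects - n from the kernel and - l/2 from the factor between
    \<open>theta_quot\<close> and \<open>g_fun\<close>.\<close>
  let ?x = "- (of_int n + real l / 2)"
  have F_eq: "?F z = ((\<Sum>j = 1..l. K * D_coeff l \<tau> j / (c * z) ^ j) + K * h z) * exp (c * of_real ?x * z)"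
    if "z \<in> ?U - {0}" for z
  proof -
    have 1: "exp (c * of_real ?x * z) = exp (- (of_nat l * of_real pi * \<i> * z)) *
        exp (- 2 * of_real pi * \<i> * of_int n * z)"
      unfolding exp_add [symmetric] by (rule arg_cong[of _ _ exp]) (simp add: c_def field_simps)
    have 2: "(\<Sum>j = 1..l. K * D_coeff l \<tau> j / (c * z) ^ j) = K * (\<Sum>j = 1..l. D_coeff l \<tau> j / (c * z) ^ j)"
      by (simp add: sum_distrib_left)
    show ?thesis
      unfolding 1 2 theta_quot_g_fun[OF \<tau>, of l z, folded q_def K_def] h(2)[OF that]
      by (simp only: distrib_left distrib_right mult_ac)
  qed
  have U: "open ?U" "0 \<in> ?U"
    using \<tau> by (auto simp: in_box_complex_iff)
  have c0: "c \<noteq> 0"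
    by (simp add: c_def)
  have res: "residue ?F 0 =
      (\<Sum>j = 1..l. K * D_coeff l \<tau> j / c ^ j * ((c * of_real ?x) ^ (j - 1) / fact (j - 1)))"
    by (rule residue_principal_part_exp[where F = ?F and D = "\<lambda>j. K * D_coeff l \<tau> j" and
          h = "\<lambda>z. K * h z" and a = "c * of_real ?x" and c = c and l = l, OF U _ F_eq c0])
       (intro holomorphic_intros h(1))
  have "(\<lambda>z. ((\<Sum>j = 1..l. K * D_coeff l \<tau> j / (c * z) ^ j) + K * h z) * exp (c * of_real ?x * z))
      holomorphic_on ?U - {0}"
    using c0 by (intro holomorphic_intros holomorphic_on_subset[OF h(1)]) auto
  then have "?F holomorphic_on ?U - {0}"
    by (rule holomorphic_transform) (rule F_eq[symmetric])
  moreover have "?F (z + 1) = ?F z" for z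
  proof -
    have "nome (z + 1) = nome z"
      by (simp add: distrib_left exp_add)
    moreover have "- 2 * of_real pi * \<i> * of_int n * (z + 1) =
        - 2 * of_real pi * \<i> * of_int n * z + \<i> * (of_int (- n) * (of_real pi * 2))"
      by (simp add: algebra_simps)
    ultimately show ?thesis
      by (simp only: exp_plus_2pin)
  qed
  moreover have "- Im \<tau> < - y" "- y < 0" "0 < y" "y < Im \<tau>"
    using \<tau> by (auto simp: y_def)
  moreover have "(?F has_contour_integral (- 1) ^ l * q powi (n + int l) * a (n + int l))
      (linepath (Complex (- 1 / 2) (- y)) (Complex (1 / 2) (- y)))"
  proof -
    have "((\<lambda>k. (- 1) ^ l * q powi (k + int l) * a (k + int l) * w powi k) has_sum theta_quot l q w) UNIV"
      if "norm w = exp (- 2 * pi * - y)" for w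
    proof (rule theta_quot_laurent_outer[OF q a])
      show "1 < norm w" "norm w < 1 / norm q"
        using that \<tau> by (auto simp: q_def norm_nome y_def exp_minus field_simps)
    qed
    from laurent_coeff_contour_integral[where x = "- 1 / 2", OF this] show ?thesis
      by simp
  qed
  moreover have "(?F has_contour_integral a n) (linepath (Complex (- 1 / 2) y) (Complex (1 / 2) y))"
  proof -
    have "((\<lambda>k. a k * w powi k) has_sum theta_quot l q w) UNIV" if "norm w = exp (- 2 * pi * y)" for w
      by (rule a) (use that \<tau> in \<open>auto simp: q_def norm_nome y_def\<close>)
    from laurent_coeff_contour_integral[where x = "- 1 / 2", OF this] show ?thesis
      by simp
  qed
  ultimately have "(- 1) ^ l * q powi (n + int l) * a (n + int l) - a n = 2 * of_real pi * \<i> * residue ?F 0"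
    by (rule periodic_strip_residue)
  also have "\<dots> = c * residue ?F 0"
    by (simp only: c_def)
  also have "\<dots> = (\<Sum>j = 1..l. c * (K * D_coeff l \<tau> j / c ^ j * ((c * of_real ?x) ^ (j - 1) / fact (j - 1))))"
    unfolding res by (rule sum_distrib_left)
  also have "\<dots> = (\<Sum>j = 1..l. K * (D_coeff l \<tau> j / fact (j - 1) * of_real ?x ^ (j - 1)))"
  proof (rule sum.cong)
    \<comment> \<open>All powers of c cancel: one comes from the residue theorem and j - 1 from the
      exponential, against c^j below.\<close>
    fix j assume "j \<in> {1..l}"
    then obtain i where "j = Suc i"
      by (cases j) auto
    then show "c * (K * D_coeff l \<tau> j / c ^ j * ((c * of_real ?x) ^ (j - 1) / fact (j - 1))) =
        K * (D_coeff l \<tau> j / fact (j - 1) * of_real ?x ^ (j - 1))"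
      using c0 by (simp add: power_mult_distrib)
  qed simp
  finally show ?thesis
    unfolding K_def by (simp only: sum_distrib_left)
qed

section \<open>The partial theta series\<close>

lemma summable_partial_theta:
  assumes "Im \<tau> > 0" "l \<ge> 1"
  shows "summable (\<lambda>n. (- 1) ^ (n * l) * of_real ((real l * real n + d) ^ k) *
    qpow \<tau> (1 / (2 * real l) * (real l * real n + d)\<^sup>2))"
proof (rule summable_comparison_test')
  \<comment> \<open>\<open>?A\<close> is the n^2 coefficient of 2 pi Im \<tau> x^2 / (2 l);
    \<open>?B\<close> joins its linear term to the slope l of the bound |x| \<le> l n + |d|.\<close>
  let ?A = "pi * Im \<tau> * real l" and ?B = "real l - 2 * pi * Im \<tau> * d"
  let ?C = "fact k * exp \<bar>d\<bar>"
  show "summable (\<lambda>n. ?C * exp (?B * real n - ?A * (real n)\<^sup>2))"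
    using assms by (intro summable_mult summable_exp_quadratic) auto
  fix n :: nat
  define x where "x = real l * real n + d"
  have "\<bar>x\<bar> ^ k \<le> fact k * exp \<bar>x\<bar>"
    by (rule power_le_fact_exp) simp
  also have "\<bar>x\<bar> \<le> real l * real n + \<bar>d\<bar>"
    unfolding x_def using abs_triangle_ineq[of "real l * real n" d] by simp
  finally have 1: "\<bar>x\<bar> ^ k \<le> fact k * exp (real l * real n + \<bar>d\<bar>)"
    by simp
  have "- 2 * pi * Im \<tau> * (1 / (2 * real l) * x\<^sup>2) = - ?A * (real n)\<^sup>2 - 2 * pi * Im \<tau> * d * real n - pi * Im \<tau> * d\<^sup>2 / real l"
    using assms by (simp add: x_def power2_eq_square field_simps)
  also have "\<dots> \<le> - ?A * (real n)\<^sup>2 - 2 * pi * Im \<tau> * d * real n"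
    using assms by simp
  finally have 2: "norm (qpow \<tau> (1 / (2 * real l) * x\<^sup>2)) \<le> exp (- ?A * (real n)\<^sup>2 - 2 * pi * Im \<tau> * d * real n)"
    by (simp add: norm_qpow)
  have "norm ((- 1) ^ (n * l) * of_real (x ^ k) * qpow \<tau> (1 / (2 * real l) * x\<^sup>2)) =
      \<bar>x\<bar> ^ k * norm (qpow \<tau> (1 / (2 * real l) * x\<^sup>2))"
    by (simp add: norm_mult norm_power power_abs)
  also have "\<dots> \<le> fact k * exp (real l * real n + \<bar>d\<bar>) * exp (- ?A * (real n)\<^sup>2 - 2 * pi * Im \<tau> * d * real n)"
    using 1 2 by (intro mult_mono) auto
  also have "\<dots> = ?C * exp (?B * real n - ?A * (real n)\<^sup>2)"
    by (simp add: mult.assoc exp_add [symmetric] algebra_simps)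
  finally show "norm ((- 1) ^ (n * l) * of_real ((real l * real n + d) ^ k) *
      qpow \<tau> (1 / (2 * real l) * (real l * real n + d)\<^sup>2)) \<le> ?C * exp (?B * real n - ?A * (real n)\<^sup>2)"
    by (simp only: x_def)
qed

lemma backward_iteration:
  fixes A c p :: "nat \<Rightarrow> 'a :: comm_ring_1"
  assumes "\<And>n. A n = c n * (A (Suc n) + p n)"
  shows "A 0 = (\<Sum>n<N. (\<Prod>k<Suc n. c k) * p n) + (\<Prod>k<N. c k) * A N"
proof (induction N)
  case (Suc N)
  have "(\<Prod>k<N. c k) * A N = (\<Prod>k<Suc N. c k) * p N + (\<Prod>k<Suc N. c k) * A (Suc N)"
    by (subst assms) (simp add: algebra_simps)
  then show ?case
    using Suc by simp
qed simp

text \<open>Unrolling the recursion N times leaves a remainder that is a product of Gaussian decay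
  times a bounded coefficient, hence tends to 0.\<close>

lemma theta_quot_coeff_sums:
  fixes a :: "int \<Rightarrow> complex" and \<tau> :: complex and l s :: nat
  defines "q \<equiv> nome \<tau>"
  defines "x \<equiv> \<lambda>n. real l * real n + (real l / 2 - real s)"
  assumes \<tau>: "Im \<tau> > 0" and l: "l \<ge> 1"
    and a: "\<And>w. norm q < norm w \<Longrightarrow> norm w < 1 \<Longrightarrow> ((\<lambda>n. a n * w powi n) has_sum theta_quot l q w) UNIV"
  shows "(\<lambda>n. \<i> ^ l / qpoch_inf q q ^ (2 * l) * (- 1) ^ (n * l) *
      qpow \<tau> (- h_exp l s - real l / 8 + 1 / (2 * real l) * (x n)\<^sup>2) *
      (\<Sum>j = 1..l. D_coeff l \<tau> j / fact (j - 1) * of_real (x n ^ (j - 1)))) sums a (int s)"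
proof -
  define P where "P = (\<lambda>n. (- \<i>) ^ l / qpoch_inf q q ^ (2 * l) *
      (\<Sum>j = 1..l. D_coeff l \<tau> j / fact (j - 1) * of_real (x n ^ (j - 1))))"
  \<comment> \<open>Going down from \<open>s\<close> (and not up) is what produces the sign in \<open>l n + l/2 - s\<close>.\<close>
  define A where "A = (\<lambda>n. a (int s - int n * int l))"
  \<comment> \<open>This inverts the multiplier (-1)^l q^(s - n l), solving the recursion for the
    coefficient of larger index.\<close>
  define c where "c = (\<lambda>n. (- 1) ^ l * q powi (int n * int l - int s))"
  have q0: "q \<noteq> 0"
    by (simp add: q_def)
  have rec: "A n = c n * (A (Suc n) + P n)" for n
  proof -
    let ?m = "int s - int (Suc n) * int l"
    have x: "- (of_int ?m + real l / 2) = x n"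
      by (simp add: x_def algebra_simps)
    have m: "?m + int l = int s - int n * int l"
      by (simp add: algebra_simps)
    have "(- 1) ^ l * q powi (int s - int n * int l) * A n - A (Suc n) = P n"
      using theta_quot_coeff_rec[OF \<tau> a[unfolded q_def], of ?m]
      unfolding x m A_def P_def q_def by simp
    then have "A (Suc n) + P n = (- 1) ^ l * q powi (int s - int n * int l) * A n"
      by (simp add: algebra_simps)
    moreover have "c n * ((- 1) ^ l * q powi (int s - int n * int l)) = 1"
    proof -
      have "q powi (int n * int l - int s) * q powi (int s - int n * int l) = 1"
        using q0 by (simp flip: power_int_add)
      then show ?thesis
        by (cases "even l") (simp_all add: c_def)
    qed
    ultimately show ?thesis
      by (metis mult.assoc mult.left_neutral)
  qed
  have prod_c: "(\<Prod>k<N. c k) = (- 1) ^ (N * l) *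
      qpow \<tau> (real l * real N * (real N - 1) / 2 - real N * real s)" for N
  proof (induction N)
    case (Suc N)
    have 1: "c N = (- 1) ^ l * qpow \<tau> (real N * real l - real s)"
      unfolding c_def q_def by (simp flip: qpow_of_int)
    have 2: "real l * real (Suc N) * (real (Suc N) - 1) / 2 - real (Suc N) * real s =
        (real l * real N * (real N - 1) / 2 - real N * real s) + (real N * real l - real s)"
      by (simp add: field_simps)
    show ?case
      unfolding prod.lessThan_Suc Suc.IH 1 2 qpow_add by (simp add: power_add mult_ac)
  qed (simp add: qpow_def)
  \<comment> \<open>The indices s - N l never exceed s, so on a circle of radius \<rho> < 1 their
    powers of \<rho> are at least \<rho>^s; absolute convergence there bounds the
    coefficients.\<close>
  obtain C where C: "norm (A N) \<le> C" for N
  proof -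
    obtain \<rho> where \<rho>: "norm q < \<rho>" "\<rho> < 1"
      using dense[OF norm_nome_less_one[OF \<tau>]] by (auto simp: q_def)
    have \<rho>0: "\<rho> > 0"
      using \<rho> norm_ge_zero[of q] by linarith
    have "((\<lambda>n. a n * of_real \<rho> powi n) has_sum theta_quot l q (of_real \<rho>)) UNIV"
      by (rule a) (use \<rho> \<rho>0 in auto)
    then have "(\<lambda>n. norm (a n * of_real \<rho> powi n)) summable_on UNIV"
      by (rule has_sum_imp_summable[THEN summable_on_iff_abs_summable_on_complex[THEN iffD1]])
    then have bound: "norm (a m * of_real \<rho> powi m) \<le> (\<Sum>\<^sub>\<infinity>n. norm (a n * of_real \<rho> powi n))" for m
      using finite_sum_le_infsum[of "\<lambda>n. norm (a n * of_real \<rho> powi n)" UNIV "{m}"] by simp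
    have "norm (A N) \<le> (\<Sum>\<^sub>\<infinity>n. norm (a n * of_real \<rho> powi n)) / \<rho> ^ s" for N
    proof -
      let ?m = "int s - int N * int l"
      have "\<rho> powi int s \<le> \<rho> powi ?m"
        using \<rho> \<rho>0 by (intro power_int_decreasing) auto
      then have "norm (A N) * \<rho> ^ s \<le> norm (a ?m) * \<rho> powi ?m"
        unfolding A_def by (intro mult_left_mono) auto
      also have "\<dots> = norm (a ?m * of_real \<rho> powi ?m)"
        using \<rho>0 by (simp add: norm_mult norm_power_int)
      also note bound
      finally show ?thesis
        using \<rho>0 by (simp add: field_simps)
    qed
    then show ?thesis
      using that by blast
  qed
  have "(\<lambda>N. (\<Prod>k<N. c k) * A N) \<longlonglongrightarrow> 0"
  proof (rule Lim_null_comparison)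
    let ?A = "pi * Im \<tau> * real l"
    let ?B = "?A + 2 * pi * Im \<tau> * real s"
    have "norm (\<Prod>k<N. c k) = exp (?B * real N - ?A * (real N)\<^sup>2)" for N
      unfolding prod_c norm_mult norm_qpow by (simp add: norm_power power2_eq_square field_simps)
    then show "\<forall>\<^sub>F N in sequentially. norm ((\<Prod>k<N. c k) * A N) \<le> exp (?B * real N - ?A * (real N)\<^sup>2) * C"
      using C by (intro always_eventually allI) (simp only: norm_mult, simp add: mult_left_mono)
    have "(\<lambda>N. exp (?B * real N - ?A * (real N)\<^sup>2)) \<longlonglongrightarrow> 0"
      using \<tau> l by (intro summable_LIMSEQ_zero summable_exp_quadratic) auto
    then show "(\<lambda>N. exp (?B * real N - ?A * (real N)\<^sup>2) * C) \<longlonglongrightarrow> 0"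
      by (rule tendsto_mult_left_zero)
  qed
  then have "(\<lambda>N. A 0 - (\<Prod>k<N. c k) * A N) \<longlonglongrightarrow> A 0 - 0"
    by (intro tendsto_diff tendsto_const)
  moreover have "A 0 - (\<Prod>k<N. c k) * A N = (\<Sum>n<N. (\<Prod>k<Suc n. c k) * P n)" for N
    using backward_iteration[of A c P N, OF rec] by (simp only: add_diff_cancel_right')
  ultimately have "(\<lambda>n. (\<Prod>k<Suc n. c k) * P n) sums A 0"
    by (simp only: sums_def diff_zero)
  also have "A 0 = a (int s)"
    by (simp add: A_def)
  also have "(\<lambda>n. (\<Prod>k<Suc n. c k) * P n) = (\<lambda>n. \<i> ^ l / qpoch_inf q q ^ (2 * l) * (- 1) ^ (n * l) *
      qpow \<tau> (- h_exp l s - real l / 8 + 1 / (2 * real l) * (x n)\<^sup>2) *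
      (\<Sum>j = 1..l. D_coeff l \<tau> j / fact (j - 1) * of_real (x n ^ (j - 1))))"
  proof
    fix n
    \<comment> \<open>Completing the square in n produces h_s and the shift l/8.\<close>
    have 1: "real l * real (Suc n) * (real (Suc n) - 1) / 2 - real (Suc n) * real s =
        - h_exp l s - real l / 8 + 1 / (2 * real l) * (x n)\<^sup>2"
      using l by (simp add: x_def h_exp_def power2_eq_square field_simps)
    have 2: "(- 1) ^ (Suc n * l) * (- \<i>) ^ l = \<i> ^ l * (- 1) ^ (n * l)"
      by (cases "even l"; cases "even n") (auto simp: power_add)
    have 3: "u * Q * (k / p * S) = (u * k) / p * Q * S" for u Q k p S :: complex
      by simp
    have 4: "(u * k) / p * Q * S = u / p * k * Q * S" for u Q k p S :: complex
      by simp
    show "(\<Prod>k<Suc n. c k) * P n = \<i> ^ l / qpoch_inf q q ^ (2 * l) * (- 1) ^ (n * l) *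
      qpow \<tau> (- h_exp l s - real l / 8 + 1 / (2 * real l) * (x n)\<^sup>2) *
      (\<Sum>j = 1..l. D_coeff l \<tau> j / fact (j - 1) * of_real (x n ^ (j - 1)))"
      unfolding prod_c P_def 1 3 2 4 ..
  qed
  finally show ?thesis .
qed

section \<open>Assembly: powers of (q)_infinity, interchange of sums, parity\<close>

theorem theorem4p2:
  fixes l s :: nat and \<tau> :: complex
  assumes "l \<ge> 3" and "Im \<tau> > 0"
  shows "F_fun l s (nome \<tau>) =
    \<i> ^ l * qpoch_inf (nome \<tau>) (nome \<tau>) ^ (l\<^sup>2 - 2 * l) * qpow \<tau> (- h_exp l s - real l / 8) *
    (\<Sum>j | 1 \<le> j \<and> j \<le> l \<and> j mod 2 = l mod 2.
       D_coeff l \<tau> j / fact (j - 1) *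
       (\<Sum>n. (- 1) ^ (n * l) *
          of_real ((real l * real n + real l / 2 - real s) ^ (j - 1)) *
          qpow \<tau> (1 / (2 * real l) * (real l * real n + real l / 2 - real s)\<^sup>2)))"
proof -
  define q where "q = nome \<tau>"
  define x where "x = (\<lambda>n. real l * real n + (real l / 2 - real s))"
  define u where "u = (\<lambda>j n. (- 1) ^ (n * l) * of_real (x n ^ (j - 1)) * qpow \<tau> (1 / (2 * real l) * (x n)\<^sup>2))"
  let ?P = "qpoch_inf q q"
  let ?C = "\<i> ^ l * ?P ^ (l\<^sup>2 - 2 * l) * qpow \<tau> (- h_exp l s - real l / 8)"
  have q: "norm q < 1"
    using norm_nome_less_one[OF assms(2)] by (simp add: q_def)
  have P0: "?P \<noteq> 0"
    using qpoch_inf_nonzero[OF q q] .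
  obtain a where a: "\<And>w. norm q < norm w \<Longrightarrow> norm w < 1 \<Longrightarrow> ((\<lambda>n. a n * w powi n) has_sum theta_quot l q w) UNIV"
    using theta_quot_laurent[OF q] by blast
  have "annulus_laurent_coeff (norm q) 1
      (\<lambda>w. ?P / (qpoch_inf w q ^ l * qpoch_inf (inverse w * q) q ^ l)) = (\<lambda>n. ?P * a n)"
  proof (rule annulus_laurent_coeff_eqI)
    fix w :: complex assume "norm q < norm w" "norm w < 1"
    from has_sum_cmult_right[OF a[OF this], of ?P]
    show "((\<lambda>n. ?P * a n * w powi n) has_sum ?P / (qpoch_inf w q ^ l * qpoch_inf (inverse w * q) q ^ l)) UNIV"
      by (simp add: theta_quot_def power_mult_distrib divide_inverse mult_ac)
  qed (use q in auto)
  then have "F_fun l s q = ?P ^ (l\<^sup>2 - 1) * (?P * a (int s))"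
    by (simp add: F_fun_def)
  also have "\<dots> = ?P ^ l\<^sup>2 * a (int s)"
    using assms(1) by (simp add: power_eq_if)
  finally have F: "F_fun l s q = ?P ^ l\<^sup>2 * a (int s)" .
  have P_eq: "?P ^ l\<^sup>2 * (\<i> ^ l / ?P ^ (2 * l)) = \<i> ^ l * ?P ^ (l\<^sup>2 - 2 * l)"
  proof -
    \<comment> \<open>Ensures that the exponent l^2 - 2 l, a subtraction of natural numbers, is not
      truncated.\<close>
    have "2 * l \<le> l\<^sup>2"
      using assms(1) by (simp add: power2_eq_square)
    then show ?thesis
      using P0 by (simp add: power_diff)
  qed
  have term_eq: "?P ^ l\<^sup>2 * (\<i> ^ l / ?P ^ (2 * l) * (- 1) ^ (n * l) *
      qpow \<tau> (- h_exp l s - real l / 8 + 1 / (2 * real l) * (x n)\<^sup>2) *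
      (\<Sum>j = 1..l. D_coeff l \<tau> j / fact (j - 1) * of_real (x n ^ (j - 1)))) =
      ?C * (\<Sum>j = 1..l. D_coeff l \<tau> j / fact (j - 1) * u j n)" for n
  proof -
    have "(\<Sum>j = 1..l. D_coeff l \<tau> j / fact (j - 1) * u j n) =
        (- 1) ^ (n * l) * qpow \<tau> (1 / (2 * real l) * (x n)\<^sup>2) *
        (\<Sum>j = 1..l. D_coeff l \<tau> j / fact (j - 1) * of_real (x n ^ (j - 1)))"
      unfolding sum_distrib_left u_def by (intro sum.cong) (simp_all only: mult_ac)
    then show ?thesis
      unfolding qpow_add P_eq[symmetric] by (simp only: mult_ac)
  qed
  have "(\<lambda>n. \<i> ^ l / ?P ^ (2 * l) * (- 1) ^ (n * l) *
      qpow \<tau> (- h_exp l s - real l / 8 + 1 / (2 * real l) * (x n)\<^sup>2) *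
      (\<Sum>j = 1..l. D_coeff l \<tau> j / fact (j - 1) * of_real (x n ^ (j - 1)))) sums a (int s)"
    unfolding x_def q_def
    by (rule theta_quot_coeff_sums) (use assms a in \<open>auto simp: q_def\<close>)
  from sums_mult[OF this, of "?P ^ l\<^sup>2"]
  have "(\<lambda>n. ?C * (\<Sum>j = 1..l. D_coeff l \<tau> j / fact (j - 1) * u j n)) sums F_fun l s q"
    unfolding term_eq F .
  \<comment> \<open>For each fixed j the series over n converges, so the finite sum over j can be
    moved outside.\<close>
  moreover have "u j sums suminf (u j)" for j
    unfolding u_def x_def
    by (intro summable_sums summable_partial_theta) (use assms in auto)
  then have "(\<lambda>n. ?C * (\<Sum>j = 1..l. D_coeff l \<tau> j / fact (j - 1) * u j n)) sums
      (?C * (\<Sum>j = 1..l. D_coeff l \<tau> j / fact (j - 1) * suminf (u j)))"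
    by (intro sums_mult sums_sum)
  ultimately have "F_fun l s q = ?C * (\<Sum>j = 1..l. D_coeff l \<tau> j / fact (j - 1) * suminf (u j))"
    by (rule sums_unique2)
  also have "(\<Sum>j = 1..l. D_coeff l \<tau> j / fact (j - 1) * suminf (u j)) =
      (\<Sum>j | 1 \<le> j \<and> j \<le> l \<and> j mod 2 = l mod 2. D_coeff l \<tau> j / fact (j - 1) * suminf (u j))"
    by (rule sum.mono_neutral_right) (use D_coeff_parity[OF assms(2)] in auto)
  finally show ?thesis
    unfolding u_def x_def q_def add_diff_eq .
qed

end
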